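(* Let $1\le r,q,s\le\infty$ with $1/q+1/r=1/s$ and $1\le v\le\infty$. The non-Archimedean stochastic integral $$(E,w)\mapsto(\hat P_wE)(t,\omega)=\sum_{j=0}^\infty E(t_j,\omega)[w(t_{j+1},\omega)-w(t_j,\omega)],\qquad t_j=\sigma_j(t),$$ is a continuous $\mathbf K$-bilinear operator from $L^r(\Omega,\mathsf F,\lambda;C^0(T,L_v(H)))\otimes L^q(\Omega,\mathsf F,\lambda;C^0_0(T,H))$ into $L^s(\Omega,\mathsf F,\lambda;C^0(T,H))$.
   Context: $\mathbf K$ is a local field containing $\mathbf Q_p$; $T=B(\mathbf K,t_0,R)$ is the closed ball of radius $0<R<\infty$ about $t_0$; $H$ is a Banach space over $\mathbf K$; $(\Omega,\mathsf F,\lambda)$ is a probability space; $C^0_0(T,H)=\{h\in C^0(T,H):h(t_0)=0\}$. The symbol $\otimes$ between spaces denotes the Cartesian product with the maximum norm (on which the bilinear operator is defined). $L_v(H)=L_v(H,H)$: for $1\le v<\infty$ it is the space of bounded linear operators $A$ on $H$ of the form $Ax=\sum_{n\ge1}a_n(x)y_n$ with $a_n\in H^*$, $y_n\in H$, $\sum_n\|a_n\|^v\|y_n\|^v<\infty$, with norm $\nu_v(A)=\inf(\sum_n\|a_n\|^v\|y_n\|^v)^{1/v}$ over all such representations; $L_\infty(H)=L(H)$ is the space of all bounded linear operators with the operator norm. For a Banach space $Z$ over $\mathbf K$, $L^s(\Omega,\mathsf F,\lambda;C^0(T,Z))$ is the completion of the simple functions $\sum_j\xi_j(t)\mathrm{Ch}_{W_j}(\omega)$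 ($\xi_j\in C^0(T,Z)$, $W_j\in\mathsf F$) in the norm $(\int_\Omega\|\xi(\cdot,\omega)\|^s_{C^0(T,Z)}\lambda(d\omega))^{1/s}$ (essential supremum if $s=\infty$), where $C^0(T,Z)$ carries the supremum norm; similarly for $C^0_0(T,H)$. Approximation of the identity: fixed maps $\sigma_n:T\to T$, $n=0,1,2,\dots$, with $\sigma_0\equiv t_0$; $\sigma_m\circ\sigma_n=\sigma_n\circ\sigma_m$ for $m\ge n$; and for some $0<\rho<1$ and all $n\ge1$: $|x-y|<\rho^n$ implies $\sigma_n(x)=\sigma_n(y)$, and $|\sigma_n(x)-x|<\rho^n$. *)

theory Defs
  imports "HOL-Probability.Probability" "HOL-Library.Function_Algebras"
begin

section \<open>Non-Archimedean fields and Banach spaces\<close>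

text \<open>The library's normed classes are real vector spaces, which p-adic spaces are not, and
  the constant \<open>norm\<close> is tied to them. The classes below add an ultrametric norm
  \<open>unorm\<close> to the library's metric spaces, so that convergence, series, balls, compactness
  and completeness are the library notions.\<close>

class ultranormed_group = ab_group_add + metric_space +
  fixes unorm :: "'a \<Rightarrow> real"
  assumes dist_unorm: "dist x y = unorm (x - y)"
    and unorm_ultrametric: "unorm (x + y) \<le> max (unorm x) (unorm y)"

class nonarch_field = field_char_0 + ultranormed_group +
  assumes unorm_multiplicative: "unorm (x * y) = unorm x * unorm y"

definition padic_abs :: "nat \<Rightarrow> rat \<Rightarrow> real" where
  "padic_abs p x = (if x = 0 then 0 else
     real p powr (real (multiplicity (int p) (snd (quotient_of x)))
                - real (multiplicity (int p) (fst (quotient_of x)))))"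

text \<open>A complete field contains \<open>Q\<^sub>p\<close> iff its absolute value induces the p-adic topology on the
  prime field: then \<open>Q\<^sub>p\<close> is the closure of the prime field. Absolute values inducing a given
  topology are powers of each other, and no normalization is imposed (\<open>c = 1\<close> gives
  \<open>\<bar>p\<bar> = 1/p\<close>, \<open>c\<close> the degree over \<open>Q\<^sub>p\<close> gives the module of the Haar measure). A locally
  compact non-Archimedean field is automatically complete, and here it is not discrete since
  \<open>0 < \<bar>p\<bar> < 1\<close>.\<close>

definition local_field_over_Qp :: "nat \<Rightarrow> 'k::nonarch_field itself \<Rightarrow> bool" where
  "local_field_over_Qp p _ \<longleftrightarrow> prime p \<and> locally compact (UNIV :: 'k set) \<and>
     (\<exists>c>0. \<forall>x. unorm (of_rat x :: 'k) = padic_abs p x powr c)"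

locale nonarch_banach_space = vector_space smul
  for smul :: "'k::nonarch_field \<Rightarrow> 'h::{ultranormed_group, complete_space} \<Rightarrow> 'h" +
  assumes unorm_smul: "unorm (smul c x) = unorm c * unorm x"


section \<open>The operator spaces \<open>L\<^sub>v(H)\<close>\<close>

definition bounded_operator ::
    "('k::field \<Rightarrow> 'a::ultranormed_group \<Rightarrow> 'a) \<Rightarrow> ('k \<Rightarrow> 'b::ultranormed_group \<Rightarrow> 'b) \<Rightarrow> ('a \<Rightarrow> 'b) \<Rightarrow> bool" where
  "bounded_operator sa sb A \<longleftrightarrow>
     Vector_Spaces.linear sa sb A \<and> (\<exists>C. \<forall>x. unorm (A x) \<le> C * unorm x)"

definition operator_norm :: "('a::ultranormed_group \<Rightarrow> 'b::ultranormed_group) \<Rightarrow> real" where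
  "operator_norm A = (SUP x. unorm (A x) / unorm x)"

definition nuclear_rep ::
    "('k::nonarch_field \<Rightarrow> 'h::ultranormed_group \<Rightarrow> 'h) \<Rightarrow> real \<Rightarrow> (nat \<Rightarrow> 'h \<Rightarrow> 'k) \<Rightarrow> (nat \<Rightarrow> 'h) \<Rightarrow> ('h \<Rightarrow> 'h) \<Rightarrow> bool" where
  "nuclear_rep smul v a y A \<longleftrightarrow>
     (\<forall>n. bounded_operator smul (*) (a n)) \<and>
     summable (\<lambda>n. operator_norm (a n) powr v * unorm (y n) powr v) \<and>
     (\<forall>x. (\<lambda>n. smul (a n x) (y n)) sums A x)"

definition Lv_space ::
    "('k::nonarch_field \<Rightarrow> 'h::ultranormed_group \<Rightarrow> 'h) \<Rightarrow> ennreal \<Rightarrow> ('h \<Rightarrow> 'h) set" where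
  "Lv_space smul v = {A. bounded_operator smul smul A \<and>
     (v = \<infinity> \<or> (\<exists>a y. nuclear_rep smul (enn2real v) a y A))}"

definition Lv_norm ::
    "('k::nonarch_field \<Rightarrow> 'h::ultranormed_group \<Rightarrow> 'h) \<Rightarrow> ennreal \<Rightarrow> ('h \<Rightarrow> 'h) \<Rightarrow> real" where
  "Lv_norm smul v A = (if v = \<infinity> then operator_norm A else
     Inf {(\<Sum>n. operator_norm (a n) powr enn2real v * unorm (y n) powr enn2real v)
            powr (1 / enn2real v) | a y. nuclear_rep smul (enn2real v) a y A})"


section \<open>Continuous functions on \<open>T\<close>\<close>

text \<open>A normed space is given from here on by a carrier set and a norm \<open>N\<close> on it, because
  \<open>L\<^sub>v(H)\<close> depends on the scalar multiplication and is therefore not a type. Vector operations on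
  functions are pointwise. An element of \<open>C\<^sup>0(T,Z)\<close> is represented by its extension by zero,
  so that equality of elements is equality of functions.\<close>

definition C0 :: "'k::metric_space set \<Rightarrow> 'z::ab_group_add set \<Rightarrow> ('z \<Rightarrow> real) \<Rightarrow> ('k \<Rightarrow> 'z) set" where
  "C0 T Z N = {f. (\<forall>t\<in>T. f t \<in> Z) \<and> (\<forall>t. t \<notin> T \<longrightarrow> f t = 0) \<and>
     (\<forall>t\<in>T. ((\<lambda>u. N (f u - f t)) \<longlongrightarrow> 0) (at t within T))}"

definition C00 :: "'k::metric_space set \<Rightarrow> 'k \<Rightarrow> 'z::ab_group_add set \<Rightarrow> ('z \<Rightarrow> real) \<Rightarrow> ('k \<Rightarrow> 'z) set" where
  "C00 T t0 Z N = {f \<in> C0 T Z N. f t0 = 0}"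

definition sup_norm :: "'k set \<Rightarrow> ('z \<Rightarrow> real) \<Rightarrow> ('k \<Rightarrow> 'z) \<Rightarrow> real" where
  "sup_norm T N f = (SUP t\<in>T. N (f t))"

definition fun_scale :: "('k \<Rightarrow> 'z \<Rightarrow> 'z) \<Rightarrow> 'k \<Rightarrow> ('i \<Rightarrow> 'z) \<Rightarrow> 'i \<Rightarrow> 'z" where
  "fun_scale sc c f = (\<lambda>i. sc c (f i))"


section \<open>The spaces \<open>L\<^sup>s(\<Omega>,F,\<lambda>;X)\<close>\<close>

definition Ls_norm :: "'w measure \<Rightarrow> ennreal \<Rightarrow> ('x \<Rightarrow> real) \<Rightarrow> ('w \<Rightarrow> 'x) \<Rightarrow> ennreal" where
  "Ls_norm M s N f = (if s = \<infinity> then esssup M (\<lambda>\<omega>. ennreal (N (f \<omega>))) else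
     (let I = (\<integral>\<^sup>+ \<omega>. ennreal (N (f \<omega>) powr enn2real s) \<partial>M)
      in if I = \<infinity> then \<infinity> else ennreal (enn2real I powr (1 / enn2real s))))"

definition simple_into :: "'w measure \<Rightarrow> 'x set \<Rightarrow> ('w \<Rightarrow> 'x) \<Rightarrow> bool" where
  "simple_into M X f \<longleftrightarrow> simple_function M f \<and> f ` space M \<subseteq> X"

text \<open>For a Banach space \<open>X\<close>, the completion of the simple functions in the norm \<open>Ls_norm\<close>
  consists of the classes, modulo almost everywhere equality, of the functions in \<open>Ls_space\<close>:
  those that are the pointwise limit of some sequence of simple functions (strong measurability)
  and the limit in \<open>Ls_norm\<close> of some sequence of simple functions. Indeed a
  Cauchy sequence of simple functions has a subsequence converging pointwise off a measurable null
  set, on which all functions can be replaced by zero. Strong measurability makes the integrands in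
  \<open>Ls_norm\<close> measurable. For \<open>s = \<infinity>\<close> one gets the closure of the finitely valued functions,
  in general smaller than the space of all essentially bounded ones.\<close>

definition Ls_space ::
    "'w measure \<Rightarrow> ennreal \<Rightarrow> 'x::ab_group_add set \<Rightarrow> ('x \<Rightarrow> real) \<Rightarrow> ('w \<Rightarrow> 'x) set" where
  "Ls_space M s X N = {f. (\<forall>\<omega>\<in>space M. f \<omega> \<in> X) \<and>
     (\<exists>G. (\<forall>n. simple_into M X (G n)) \<and>
          (\<forall>\<omega>\<in>space M. (\<lambda>n. N (G n \<omega> - f \<omega>)) \<longlonglongrightarrow> 0)) \<and>
     (\<exists>F. (\<forall>n. simple_into M X (F n)) \<and> (\<lambda>n. Ls_norm M s N (F n - f)) \<longlonglongrightarrow> 0)}"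

text \<open>Continuous bilinear operators between spaces of (representatives of) classes modulo almost
  everywhere equality. The spaces are given by carriers \<open>A\<close>, \<open>B\<close>, \<open>C\<close> with norms and scalar
  multiplications; the product \<open>A \<times> B\<close> carries the maximum norm. The second conjunct says
  that the operator is well defined on classes.\<close>

definition continuous_bilinear_AE ::
    "'w measure \<Rightarrow>
     ('k \<Rightarrow> ('w \<Rightarrow> 'a::ab_group_add) \<Rightarrow> ('w \<Rightarrow> 'a)) \<Rightarrow> ('w \<Rightarrow> 'a) set \<Rightarrow> (('w \<Rightarrow> 'a) \<Rightarrow> ennreal) \<Rightarrow>
     ('k \<Rightarrow> ('w \<Rightarrow> 'b::ab_group_add) \<Rightarrow> ('w \<Rightarrow> 'b)) \<Rightarrow> ('w \<Rightarrow> 'b) set \<Rightarrow> (('w \<Rightarrow> 'b) \<Rightarrow> ennreal) \<Rightarrow>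
     ('k \<Rightarrow> ('w \<Rightarrow> 'c::ab_group_add) \<Rightarrow> ('w \<Rightarrow> 'c)) \<Rightarrow> ('w \<Rightarrow> 'c) set \<Rightarrow> (('w \<Rightarrow> 'c) \<Rightarrow> ennreal) \<Rightarrow>
     (('w \<Rightarrow> 'a) \<Rightarrow> ('w \<Rightarrow> 'b) \<Rightarrow> ('w \<Rightarrow> 'c)) \<Rightarrow> bool" where
  "continuous_bilinear_AE M sA A NA sB B NB sC C NC P \<longleftrightarrow>
     (\<forall>f\<in>A. \<forall>g\<in>B. P f g \<in> C) \<and>
     (\<forall>f\<in>A. \<forall>f'\<in>A. \<forall>g\<in>B. \<forall>g'\<in>B. (AE \<omega> in M. f \<omega> = f' \<omega>) \<longrightarrow> (AE \<omega> in M. g \<omega> = g' \<omega>) \<longrightarrow>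
        (AE \<omega> in M. P f g \<omega> = P f' g' \<omega>)) \<and>
     (\<forall>f\<in>A. \<forall>f'\<in>A. \<forall>g\<in>B. AE \<omega> in M. P (f + f') g \<omega> = (P f g + P f' g) \<omega>) \<and>
     (\<forall>f\<in>A. \<forall>g\<in>B. \<forall>g'\<in>B. AE \<omega> in M. P f (g + g') \<omega> = (P f g + P f g') \<omega>) \<and>
     (\<forall>c. \<forall>f\<in>A. \<forall>g\<in>B. AE \<omega> in M. P (sA c f) g \<omega> = sC c (P f g) \<omega>) \<and>
     (\<forall>c. \<forall>f\<in>A. \<forall>g\<in>B. AE \<omega> in M. P f (sB c g) \<omega> = sC c (P f g) \<omega>) \<and>
     (\<forall>f\<in>A. \<forall>g\<in>B. \<forall>\<epsilon>>0. \<exists>\<delta>>0. \<forall>f'\<in>A. \<forall>g'\<in>B.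
        max (NA (f' - f)) (NB (g' - g)) < ennreal \<delta> \<longrightarrow> NC (P f' g' - P f g) < ennreal \<epsilon>)"


section \<open>The stochastic integral\<close>

definition approximation_of_identity ::
    "'k::ultranormed_group set \<Rightarrow> 'k \<Rightarrow> (nat \<Rightarrow> 'k \<Rightarrow> 'k) \<Rightarrow> bool" where
  "approximation_of_identity T t0 \<sigma> \<longleftrightarrow>
     (\<forall>n. \<forall>x\<in>T. \<sigma> n x \<in> T) \<and>
     (\<forall>x\<in>T. \<sigma> 0 x = t0) \<and>
     (\<forall>m n. m \<ge> n \<longrightarrow> (\<forall>x\<in>T. \<sigma> m (\<sigma> n x) = \<sigma> n (\<sigma> m x))) \<and>
     (\<exists>\<rho>::real. 0 < \<rho> \<and> \<rho> < 1 \<and> (\<forall>n\<ge>1. \<forall>x\<in>T.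
        (\<forall>y\<in>T. unorm (x - y) < \<rho> ^ n \<longrightarrow> \<sigma> n x = \<sigma> n y) \<and> unorm (\<sigma> n x - x) < \<rho> ^ n))"

definition integral_term ::
    "(nat \<Rightarrow> 'k \<Rightarrow> 'k) \<Rightarrow> ('w \<Rightarrow> 'k \<Rightarrow> 'h \<Rightarrow> 'h) \<Rightarrow> ('w \<Rightarrow> 'k \<Rightarrow> 'h::ab_group_add) \<Rightarrow> 'w \<Rightarrow> 'k \<Rightarrow> nat \<Rightarrow> 'h" where
  "integral_term \<sigma> E w \<omega> t j = E \<omega> (\<sigma> j t) (w \<omega> (\<sigma> (Suc j) t) - w \<omega> (\<sigma> j t))"

text \<open>Outside \<open>T\<close> the value is zero, matching the representation of \<open>C\<^sup>0(T,H)\<close>.\<close>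

definition stochastic_integral ::
    "'k set \<Rightarrow> (nat \<Rightarrow> 'k \<Rightarrow> 'k) \<Rightarrow> ('w \<Rightarrow> 'k \<Rightarrow> 'h \<Rightarrow> 'h) \<Rightarrow> ('w \<Rightarrow> 'k \<Rightarrow> 'h::ultranormed_group) \<Rightarrow> 'w \<Rightarrow> 'k \<Rightarrow> 'h" where
  "stochastic_integral T \<sigma> E w = (\<lambda>\<omega> t. if t \<in> T then (\<Sum>j. integral_term \<sigma> E w \<omega> t j) else 0)"

end

theory Submission
  imports Defs
begin

text \<open>
  Fix \<open>\<omega>\<close>. The points \<open>t\<^sub>j = \<sigma>\<^sub>j t\<close> satisfy \<open>\<bar>t\<^bsub>j+1\<^esub> - t\<^sub>j\<bar> < \<rho>\<^sup>j\<close> for \<open>j \<ge> 1\<close>. Since \<open>T\<close> is a ball in a locally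
  compact field, it is compact, so a path \<open>h\<close> is uniformly continuous and its increments
  \<open>h t\<^bsub>j+1\<^esub> - h t\<^sub>j\<close> tend to zero uniformly in \<open>t\<close>. The operators \<open>e t\<close> are bounded on \<open>T\<close> by the supremum
  norm of \<open>e\<close>, because \<open>\<nu>\<^sub>v\<close> dominates the operator norm. In a complete ultrametric space a series
  whose terms tend to zero converges, and its sum is no larger than its largest term. Hence
  the series defining the integral \<open>I(e, h)\<close> of a path converges, depends continuously on \<open>t\<close> (the maps
  \<open>\<sigma>\<^sub>j\<close> are locally constant, and the tail is uniformly small), is bilinear, and satisfies
  \<open>\<parallel>I(e, h)\<parallel> \<le> \<parallel>e\<parallel> \<parallel>h\<parallel>\<close> (\<open>pathwise_integral_C0\<close>, \<open>pathwise_integral_le\<close>). Over the reals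
  a path of this kind could have infinite variation and the series could diverge; here it is
  enough that its terms tend to zero.

  The stochastic integral applies this bilinear map for each \<open>\<omega>\<close> separately. The passage to the
  spaces \<open>L\<^sup>s\<close> is then a general fact on bounded pairings (\<open>pairing_Ls_space\<close>, \<open>pairing_continuous\<close>).
  From \<open>I(e', h') - I(e, h) = I(e' - e, h') + I(e, h' - h)\<close> one has the pointwise bound
  \<open>\<parallel>e' - e\<parallel> \<parallel>h'\<parallel> + \<parallel>e\<parallel> \<parallel>h' - h\<parallel>\<close>, whose \<open>L\<^sup>s\<close> norm is controlled by Hoelder's inequality for
  \<open>1/q + 1/r = 1/s\<close> and Minkowski's inequality. This gives continuity, and applied to approximating
  simple functions it shows that the integral lies in \<open>L\<^sup>s\<close>. Minkowski's inequality is needed even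
  though \<open>H\<close> is ultrametric, since integration over \<open>\<Omega>\<close> respects only the ordinary triangle
  inequality.
\<close>

section \<open>Ultrametric groups\<close>

lemma unorm_eq_dist: "unorm x = dist x (0::'a::ultranormed_group)"
  by (simp add: dist_unorm)

lemma unorm_nonneg [simp]: "0 \<le> unorm (x::'a::ultranormed_group)"
  by (simp add: unorm_eq_dist)

lemma unorm_zero [simp]: "unorm (0::'a::ultranormed_group) = 0"
  by (simp add: unorm_eq_dist)

lemma unorm_eq_0_iff [simp]: "unorm x = 0 \<longleftrightarrow> x = (0::'a::ultranormed_group)"
  by (simp add: unorm_eq_dist)

lemma unorm_minus_commute: "unorm (x - y) = unorm (y - (x::'a::ultranormed_group))"
  by (metis dist_commute dist_unorm)

lemma unorm_minus [simp]: "unorm (- x) = unorm (x::'a::ultranormed_group)"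
  using unorm_minus_commute[of 0 x] by simp

lemma unorm_add_le: "unorm x \<le> B \<Longrightarrow> unorm y \<le> B \<Longrightarrow> unorm (x + y) \<le> B"
  for x :: "'a::ultranormed_group"
  using unorm_ultrametric[of x y] by linarith

lemma unorm_diff_le: "unorm x \<le> B \<Longrightarrow> unorm y \<le> B \<Longrightarrow> unorm (x - y) \<le> B"
  for x :: "'a::ultranormed_group"
  using unorm_add_le[of x B "- y"] by simp

lemma tendsto_unorm_iff: "(f \<longlongrightarrow> l) F \<longleftrightarrow> ((\<lambda>x. unorm (f x - l)) \<longlongrightarrow> 0) F"
  for l :: "'a::ultranormed_group"
  unfolding dist_unorm[symmetric] by (rule tendsto_dist_iff)

text \<open>This makes the library's rules on sums of limits and of series available.\<close>

instance ultranormed_group \<subseteq> topological_ab_group_add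
proof
  fix a b :: 'a
  have "dist (x + y) (a + b) \<le> max (dist x a) (dist y b)" for x y
    using unorm_ultrametric[of "x - a" "y - b"] by (simp add: dist_unorm algebra_simps)
  then have le: "dist (fst z + snd z) (a + b) \<le> max (dist (fst z) a) (dist (snd z) b)" for z
    by blast
  have "((\<lambda>z. dist (fst z) a) \<longlongrightarrow> 0) (nhds a \<times>\<^sub>F nhds b)"
    using filterlim_fst[of "nhds a" "nhds b"] by (simp add: tendsto_dist_iff[of fst])
  moreover have "((\<lambda>z. dist (snd z) b) \<longlongrightarrow> 0) (nhds a \<times>\<^sub>F nhds b)"
    using filterlim_snd[of "nhds b" "nhds a"] by (simp add: tendsto_dist_iff[of snd])
  ultimately have "((\<lambda>z. max (dist (fst z) a) (dist (snd z) b)) \<longlongrightarrow> 0) (nhds a \<times>\<^sub>F nhds b)"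
    using tendsto_max by fastforce
  then have "((\<lambda>z. dist (fst z + snd z) (a + b)) \<longlongrightarrow> 0) (nhds a \<times>\<^sub>F nhds b)"
    by (rule Lim_null_comparison[rotated]) (simp add: le)
  then show "LIM x (nhds a \<times>\<^sub>F nhds b). fst x + snd x :> nhds (a + b)"
    by (simp add: tendsto_dist_iff[of "\<lambda>z. fst z + snd z"])
next
  fix a :: 'a
  have "dist (- x) (- a) = dist x a" for x
    using unorm_minus_commute[of a x] by (simp add: dist_unorm)
  moreover have "((\<lambda>x. dist x a) \<longlongrightarrow> 0) (nhds a)"
    using filterlim_ident[of "nhds a"] by (simp add: tendsto_dist_iff[of "\<lambda>x. x"])
  ultimately show "(uminus \<longlongrightarrow> - a) (nhds a)"
    by (simp add: tendsto_dist_iff[of uminus])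
qed

lemma unorm_sum_le:
  fixes f :: "'i \<Rightarrow> 'a::ultranormed_group"
  assumes "\<And>i. i \<in> S \<Longrightarrow> unorm (f i) \<le> B" and "0 \<le> B"
  shows "unorm (sum f S) \<le> B"
  using assms by (induction S rule: infinite_finite_induct) (auto intro: unorm_add_le)

text \<open>The strong triangle inequality passes to the limit because closed balls are closed.\<close>

lemma unorm_sums_le:
  fixes f :: "nat \<Rightarrow> 'a::ultranormed_group"
  assumes "f sums l" and "\<And>n. unorm (f n) \<le> B"
  shows "unorm l \<le> B"
proof -
  have "0 \<le> B"
    using assms(2)[of 0] unorm_nonneg[of "f 0"] by linarith
  then have "dist (\<Sum>i<n. f i) 0 \<le> B" for n
    using assms(2) by (simp add: unorm_sum_le flip: unorm_eq_dist)
  moreover have "(\<lambda>n. dist (\<Sum>i<n. f i) 0) \<longlonglongrightarrow> dist l 0"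
    using assms(1) unfolding sums_def by (intro tendsto_intros)
  ultimately have "dist l 0 \<le> B"
    by (intro LIMSEQ_le_const2) auto
  then show ?thesis
    by (simp add: unorm_eq_dist)
qed

text \<open>In a complete ultrametric group a series converges as soon as its terms tend to zero:
  a block of the series is no larger than its largest term, so the partial sums are Cauchy.\<close>

lemma summable_if_terms_vanish:
  fixes f :: "nat \<Rightarrow> 'a::{ultranormed_group, complete_space}"
  assumes "(\<lambda>n. unorm (f n)) \<longlonglongrightarrow> 0"
  shows "summable f"
proof -
  have "Cauchy (\<lambda>n. \<Sum>i<n. f i)"
  proof (rule metric_CauchyI)
    fix e :: real assume "0 < e"
    then obtain K where K: "\<And>n. n \<ge> K \<Longrightarrow> unorm (f n) < e / 2"
      using order_tendstoD(2)[OF assms, of "e / 2"] by (auto simp: eventually_sequentially)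
    have block: "dist (\<Sum>i<m. f i) (\<Sum>i<n. f i) \<le> e / 2" if "K \<le> n" "n \<le> m" for m n
    proof -
      have "(\<Sum>i<m. f i) - (\<Sum>i<n. f i) = (\<Sum>i=n..<m. f i)"
        using that sum_diff_nat_ivl[of 0 n m f] by (simp add: atLeast0LessThan)
      moreover have "unorm (\<Sum>i=n..<m. f i) \<le> e / 2"
        using that \<open>0 < e\<close> by (intro unorm_sum_le less_imp_le[OF K]) auto
      ultimately show ?thesis
        by (simp add: dist_unorm)
    qed
    show "\<exists>K. \<forall>m\<ge>K. \<forall>n\<ge>K. dist (\<Sum>i<m. f i) (\<Sum>i<n. f i) < e"
    proof (intro exI allI impI)
      fix m n assume "K \<le> m" "K \<le> n"
      then have "dist (\<Sum>i<m. f i) (\<Sum>i<n. f i) \<le> e / 2"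
        using block[of n m] block[of m n] by (cases "n \<le> m") (auto simp: dist_commute)
      then show "dist (\<Sum>i<m. f i) (\<Sum>i<n. f i) < e"
        using \<open>0 < e\<close> by linarith
    qed
  qed
  then show ?thesis
    by (simp add: Cauchy_convergent_iff summable_iff_convergent)
qed

lemma sums_uminus:
  fixes f :: "nat \<Rightarrow> 'a::topological_ab_group_add"
  assumes "f sums a"
  shows "(\<lambda>n. - f n) sums (- a)"
  using assms unfolding sums_def by (simp add: sum_negf tendsto_minus)

lemma sums_group_diff:
  fixes f g :: "nat \<Rightarrow> 'a::{topological_ab_group_add, t2_space}"
  assumes "f sums a" and "g sums b"
  shows "(\<lambda>n. f n - g n) sums (a - b)"
  using sums_add[OF assms(1) sums_uminus[OF assms(2)]] by simp

lemma sums_interleave: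
  fixes f g :: "nat \<Rightarrow> 'a::{topological_comm_monoid_add, t2_space}"
  assumes "f sums a" and "g sums b"
  shows "(\<lambda>n. if even n then f (n div 2) else g (n div 2)) sums (a + b)"
proof -
  let ?F = "\<lambda>n. if even n then f (n div 2) else 0"
  let ?G = "\<lambda>n. if even n then 0 else g (n div 2)"
  have "?F sums a"
    using assms(1) by (subst sums_mono_reindex[of "\<lambda>n. 2 * n", symmetric])
      (auto simp: strict_mono_def elim!: evenE)
  moreover have "?G sums b"
    using assms(2) by (subst sums_mono_reindex[of "\<lambda>n. 2 * n + 1", symmetric])
      (auto simp: strict_mono_def elim!: oddE)
  ultimately have "(\<lambda>n. ?F n + ?G n) sums (a + b)"
    by (rule sums_add)
  then show ?thesis
    by (rule sums_cong[THEN iffD1, rotated]) simp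
qed

lemma unorm_one [simp]: "unorm (1::'k::nonarch_field) = 1"
proof -
  have "unorm (1::'k) * unorm (1::'k) = unorm (1::'k)"
    by (simp flip: unorm_multiplicative)
  then show ?thesis
    by (metis mult_cancel_left2 unorm_eq_0_iff zero_neq_one)
qed

lemma unorm_power: "unorm (x ^ n) = unorm (x::'k::nonarch_field) ^ n"
  by (induction n) (simp_all add: unorm_multiplicative)

text \<open>Multiplication by a power of \<open>p\<close>, whose absolute value is less than one, maps
  a given ball into a compact neighbourhood of zero.\<close>

lemma compact_cball_local_field:
  fixes t0 :: "'k::nonarch_field"
  assumes K: "local_field_over_Qp p TYPE('k)"
  shows "compact (cball t0 R)"
proof -
  obtain c where p: "prime p" and c: "c > 0"
    and abs: "\<And>x. unorm (of_rat x :: 'k) = padic_abs p x powr c"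
    and loc: "locally compact (UNIV :: 'k set)"
    using K unfolding local_field_over_Qp_def by blast
  obtain U V :: "'k set" where UV: "open U" "compact V" "0 \<in> U" "U \<subseteq> V"
  proof -
    have "\<forall>W (x::'k). open W \<and> x \<in> W \<longrightarrow>
        (\<exists>U. open U \<and> (\<exists>V. compact V \<and> x \<in> U \<and> U \<subseteq> V \<and> V \<subseteq> W))"
      using loc by (simp add: locally_def)
    from this[rule_format, of UNIV 0] show ?thesis
      using that by auto
  qed
  obtain e where e: "e > 0" "cball 0 e \<subseteq> U"
    using UV open_contains_cball by blast
  have cpt: "compact (cball (0::'k) e)"
    using UV e compact_Int_closed[of V "cball 0 e"] by (simp add: Int_absorb1 subset_trans)
  define \<pi> :: 'k where "\<pi> = of_rat (of_nat p)"
  have p1: "1 < p"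
    using p prime_gt_1_nat by blast
  have quot: "quotient_of (of_nat p) = (int p, 1)"
    using quotient_of_int[of "int p"] by (simp add: of_int_def[symmetric])
  have "multiplicity (int p) (int p) = 1"
    using p1 by (intro multiplicity_self) auto
  then have "padic_abs p (of_nat p) = real p powr - 1"
    using p1 quot by (simp add: padic_abs_def)
  then have "unorm \<pi> = (real p powr - 1) powr c"
    using abs[of "of_nat p"] by (simp add: \<pi>_def)
  also have "\<dots> = real p powr - c"
    by (subst powr_powr) simp
  finally have "unorm \<pi> = real p powr - c" .
  then have \<pi>: "0 < unorm \<pi>" "unorm \<pi> < 1"
    using p1 c by (auto simp: powr_less_one)
  have "(\<lambda>n. unorm \<pi> ^ n * R) \<longlonglongrightarrow> 0 * R"
    using \<pi> by (intro tendsto_intros LIMSEQ_realpow_zero) auto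
  then have "eventually (\<lambda>n. unorm \<pi> ^ n * R < e) sequentially"
    using e by (intro order_tendstoD(2)[where a = e]) auto
  then obtain n where n: "unorm \<pi> ^ n * R < e"
    by (auto simp: eventually_sequentially)
  \<comment> \<open>The affine map \<open>\<phi>\<close> undoes the contraction; its image of the compact ball contains the given ball.\<close>
  define \<phi> where "\<phi> y = t0 + inverse (\<pi> ^ n) * y" for y
  have "\<pi> \<noteq> 0"
    using \<pi> by auto
  have "dist (\<phi> x) (\<phi> y) = unorm (inverse (\<pi> ^ n)) * dist x y" for x y
    by (simp add: \<phi>_def dist_unorm flip: unorm_multiplicative right_diff_distrib)
  then have "(unorm (inverse (\<pi> ^ n)))-lipschitz_on (cball 0 e) \<phi>"
    by (intro lipschitz_onI) auto
  then have "compact (\<phi> ` cball 0 e)"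
    by (intro compact_continuous_image cpt lipschitz_on_continuous_on)
  moreover have "cball t0 R \<subseteq> \<phi> ` cball 0 e"
  proof
    fix x assume "x \<in> cball t0 R"
    then have "unorm (x - t0) \<le> R"
      by (simp add: dist_unorm unorm_minus_commute)
    then have "unorm (\<pi> ^ n * (x - t0)) \<le> unorm \<pi> ^ n * R"
      by (simp add: unorm_multiplicative unorm_power mult_left_mono)
    then have "\<pi> ^ n * (x - t0) \<in> cball 0 e"
      using n by (simp add: dist_unorm)
    moreover have "x = \<phi> (\<pi> ^ n * (x - t0))"
      using \<open>\<pi> \<noteq> 0\<close> by (simp add: \<phi>_def flip: mult.assoc)
    ultimately show "x \<in> \<phi> ` cball 0 e"
      by blast
  qed
  ultimately show ?thesis
    using compact_Int_closed[of "\<phi> ` cball 0 e" "cball t0 R"] by (simp add: Int_absorb1)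
qed

section \<open>Normed groups given by a carrier and a norm\<close>

text \<open>The spaces \<open>L\<^sub>v(H)\<close>, \<open>H\<close> and the spaces of continuous functions over them are treated alike. The
  single inequality for differences gives, with \<open>N 0 = 0\<close>, both the symmetry of \<open>N\<close> and the triangle
  inequality. It is the ordinary and not the strong triangle inequality, because for finite
  \<open>v\<close> the \<open>v\<close>-th powers of two representations add up in \<open>\<nu>\<^sub>v\<close>.\<close>

locale normed_carrier =
  fixes Z :: "'z::ab_group_add set" and N :: "'z \<Rightarrow> real"
  assumes zero_mem: "0 \<in> Z"
    and diff_mem: "x \<in> Z \<Longrightarrow> y \<in> Z \<Longrightarrow> x - y \<in> Z"
    and norm_zero: "N 0 = 0"
    and norm_nonneg: "x \<in> Z \<Longrightarrow> 0 \<le> N x"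
    and norm_diff_le: "x \<in> Z \<Longrightarrow> y \<in> Z \<Longrightarrow> N (x - y) \<le> N x + N y"
begin

lemma norm_diff_commute: "x \<in> Z \<Longrightarrow> y \<in> Z \<Longrightarrow> N (x - y) = N (y - x)"
  using norm_diff_le[OF zero_mem, of "x - y"] norm_diff_le[OF zero_mem, of "y - x"]
  by (simp add: diff_mem norm_zero)

lemma norm_le_diff: "x \<in> Z \<Longrightarrow> y \<in> Z \<Longrightarrow> N x \<le> N (x - y) + N y"
  using norm_diff_le[of "x - y" "0 - y"] norm_diff_commute[of 0 y] diff_mem[of 0 y]
  by (simp add: diff_mem zero_mem)

lemma abs_norm_diff_le: "x \<in> Z \<Longrightarrow> y \<in> Z \<Longrightarrow> \<bar>N x - N y\<bar> \<le> N (x - y)"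
  using norm_le_diff[of x y] norm_le_diff[of y x] norm_diff_commute[of x y] by linarith

end

lemma normed_carrier_unorm: "normed_carrier (UNIV :: 'a::ultranormed_group set) unorm"
proof
  fix x y :: 'a
  show "unorm (x - y) \<le> unorm x + unorm y"
    by (intro unorm_diff_le) auto
qed auto

text \<open>Continuous functions into a normed carrier are not continuous in the sense of a type class, since
  the norm induces no topology on the type. Their norms are bounded on compact sets because they
  are locally bounded.\<close>

lemma compact_local_bound:
  fixes g :: "'a::topological_space \<Rightarrow> real"
  assumes "compact T"
    and "\<And>t. t \<in> T \<Longrightarrow> \<exists>U B. open U \<and> t \<in> U \<and> (\<forall>u\<in>U \<inter> T. g u \<le> B)"
  shows "bdd_above (g ` T)"
proof -
  obtain U B where UB: "\<And>t. t \<in> T \<Longrightarrow> open (U t) \<and> t \<in> U t \<and> (\<forall>u\<in>U t \<inter> T. g u \<le> B t)"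
    using assms(2) by metis
  obtain C where C: "C \<subseteq> T" "finite C" "T \<subseteq> (\<Union>c\<in>C. U c)"
  proof (rule compactE_image[OF assms(1), of T U])
    show "T \<subseteq> (\<Union>c\<in>T. U c)"
      using UB by blast
  qed (use UB in auto)
  show ?thesis
  proof (rule bdd_above.I2)
    fix t assume "t \<in> T"
    then obtain c where c: "c \<in> C" "t \<in> U c"
      using C by blast
    then have "g t \<le> B c"
      using UB C \<open>t \<in> T\<close> by blast
    also have "B c \<le> Max (B ` C)"
      using C c by simp
    finally show "g t \<le> Max (B ` C)" .
  qed
qed

context normed_carrier
begin

lemma C0_mem: "f \<in> C0 T Z N \<Longrightarrow> t \<in> T \<Longrightarrow> f t \<in> Z"
  by (simp add: C0_def)

text \<open>The supremum norm is a supremum of reals, so it says something about the values of a function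
  only once they are known to be bounded. This is where the compactness of \<open>T\<close> enters.\<close>

lemma C0_bdd_above:
  assumes "compact T" and f: "f \<in> C0 T Z N"
  shows "bdd_above ((\<lambda>t. N (f t)) ` T)"
proof (rule compact_local_bound[OF assms(1)])
  fix t assume t: "t \<in> T"
  have "((\<lambda>u. N (f u - f t)) \<longlongrightarrow> 0) (at t within T)"
    using f t by (simp add: C0_def)
  then have "eventually (\<lambda>u. N (f u - f t) < 1) (at t within T)"
    by (rule order_tendstoD) simp
  then obtain U where U: "open U" "t \<in> U" "\<And>u. u \<in> U \<Longrightarrow> u \<noteq> t \<Longrightarrow> u \<in> T \<Longrightarrow> N (f u - f t) < 1"
    unfolding eventually_at_topological by blast
  have "N (f u) \<le> 1 + N (f t)" if "u \<in> U \<inter> T" for u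
  proof (cases "u = t")
    case False
    then show ?thesis
      using U(3)[of u] that norm_le_diff[of "f u" "f t"] C0_mem[OF f] t by fastforce
  qed simp
  then show "\<exists>U B. open U \<and> t \<in> U \<and> (\<forall>u\<in>U \<inter> T. N (f u) \<le> B)"
    using U by blast
qed

lemma norm_le_sup_norm:
  assumes "compact T" and "f \<in> C0 T Z N" and "t \<in> T"
  shows "N (f t) \<le> sup_norm T N f"
  unfolding sup_norm_def by (intro cSUP_upper assms C0_bdd_above)

lemma normed_carrier_C0:
  assumes T: "compact T" "T \<noteq> {}"
  shows "normed_carrier (C0 T Z N) (sup_norm T N)"
proof
  show "0 \<in> C0 T Z N"
    by (simp add: C0_def zero_mem norm_zero)
  show "sup_norm T N 0 = 0"
    using T by (simp add: sup_norm_def norm_zero)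
next
  fix f assume f: "f \<in> C0 T Z N"
  obtain t where "t \<in> T"
    using T by blast
  then show "0 \<le> sup_norm T N f"
    using norm_le_sup_norm[OF T(1) f, of t] norm_nonneg[OF C0_mem[OF f, of t]] by simp
next
  fix f g assume f: "f \<in> C0 T Z N" and g: "g \<in> C0 T Z N"
  show "f - g \<in> C0 T Z N"
    unfolding C0_def
  proof (safe)
    fix t assume t: "t \<in> T"
    then show "(f - g) t \<in> Z"
      using C0_mem[OF f] C0_mem[OF g] by (simp add: diff_mem)
    show "((\<lambda>u. N ((f - g) u - (f - g) t)) \<longlongrightarrow> 0) (at t within T)"
    proof (rule tendsto_sandwich)
      show "\<forall>\<^sub>F u in at t within T. 0 \<le> N ((f - g) u - (f - g) t)"
        using t by (simp add: eventually_at_filter C0_mem[OF f] C0_mem[OF g] norm_nonneg diff_mem)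
      have "N ((f - g) u - (f - g) t) \<le> N (f u - f t) + N (g u - g t)" if "u \<in> T" for u
        using norm_diff_le[of "f u - f t" "g u - g t"] that t
        by (simp add: C0_mem[OF f] C0_mem[OF g] diff_mem algebra_simps)
      then show "\<forall>\<^sub>F u in at t within T. N ((f - g) u - (f - g) t) \<le> N (f u - f t) + N (g u - g t)"
        by (simp add: eventually_at_filter)
      show "((\<lambda>u. N (f u - f t) + N (g u - g t)) \<longlongrightarrow> 0) (at t within T)"
        using f g t by (intro tendsto_add_zero) (auto simp: C0_def)
    qed simp
  next
    fix t assume "t \<notin> T"
    then show "(f - g) t = 0"
      using f g by (simp add: C0_def)
  qed
  show "sup_norm T N (f - g) \<le> sup_norm T N f + sup_norm T N g"
    unfolding sup_norm_def[of T N "f - g"]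
  proof (rule cSUP_least[OF T(2)])
    fix t assume t: "t \<in> T"
    have "N ((f - g) t) \<le> N (f t) + N (g t)"
      using t by (simp add: C0_mem[OF f] C0_mem[OF g] norm_diff_le)
    also have "\<dots> \<le> sup_norm T N f + sup_norm T N g"
      by (intro add_mono norm_le_sup_norm T f g t)
    finally show "N ((f - g) t) \<le> sup_norm T N f + sup_norm T N g" .
  qed
qed

end

section \<open>Bounded operators and the spaces \<open>L\<^sub>v(H)\<close>\<close>

text \<open>As for the supremum norm, boundedness makes the supremum in the operator norm meaningful. At
  \<open>x = 0\<close> the quotient is zero by the convention for division.\<close>

lemma bounded_operator_bdd_above:
  assumes "bounded_operator sa sb A"
  shows "bdd_above (range (\<lambda>x. unorm (A x) / unorm x))"
proof -
  obtain C where C: "\<And>x. unorm (A x) \<le> C * unorm x"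
    using assms by (auto simp: bounded_operator_def)
  have "unorm (A x) / unorm x \<le> max C 0" for x
  proof (cases "x = 0")
    case False
    then have "unorm (A x) / unorm x \<le> C"
      using C[of x] unorm_nonneg[of x] by (simp add: divide_simps le_less)
    then show ?thesis
      by simp
  qed simp
  then show ?thesis
    by (intro bdd_above.I2) auto
qed

lemma operator_norm_nonneg: "bounded_operator sa sb A \<Longrightarrow> 0 \<le> operator_norm A"
  using cSUP_upper[OF UNIV_I bounded_operator_bdd_above, of sa sb A 0]
  by (simp add: operator_norm_def)

lemma unorm_le_operator_norm:
  assumes "bounded_operator sa sb A"
  shows "unorm (A x) \<le> operator_norm A * unorm x"
proof (cases "x = 0")
  case True
  then show ?thesis
    using assms by (auto simp: bounded_operator_def dest: spec[of _ 0])
next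
  case False
  then have "0 < unorm x"
    using unorm_nonneg[of x] unorm_eq_0_iff[of x] by linarith
  then show ?thesis
    using cSUP_upper[OF UNIV_I bounded_operator_bdd_above[OF assms], of x]
    by (simp add: operator_norm_def pos_divide_le_eq)
qed

lemma operator_norm_le:
  assumes "\<And>x. unorm (A x) \<le> C * unorm x" and "0 \<le> C"
  shows "operator_norm A \<le> C"
proof -
  have "unorm (A x) / unorm x \<le> C" for x
    using assms(1)[of x] assms(2) unorm_nonneg[of x] by (cases "x = 0") (auto simp: divide_simps le_less)
  then show ?thesis
    unfolding operator_norm_def by (intro cSUP_least) auto
qed

lemma bounded_operator_zero:
  assumes "vector_space sa" and "vector_space sb"
  shows "bounded_operator sa sb (\<lambda>_. 0)"
  using assms module.scale_zero_right[of sb] exI[of "\<lambda>C. \<forall>x. 0 \<le> C * unorm x" 0]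
  by (simp add: bounded_operator_def Vector_Spaces.linear_iff module_iff_vector_space)

lemma operator_norm_zero [simp]: "operator_norm (\<lambda>_. 0) = 0"
  by (simp add: operator_norm_def)

lemma bounded_operator_diff:
  assumes A: "bounded_operator sa sb A" and B: "bounded_operator sa sb B"
  shows "bounded_operator sa sb (\<lambda>x. A x - B x)"
    and "operator_norm (\<lambda>x. A x - B x) \<le> operator_norm A + operator_norm B"
proof -
  have bound: "unorm (A x - B x) \<le> (operator_norm A + operator_norm B) * unorm x" for x
  proof -
    have "unorm (A x - B x) \<le> unorm (A x) + unorm (B x)"
      by (intro unorm_diff_le) auto
    also have "\<dots> \<le> operator_norm A * unorm x + operator_norm B * unorm x"
      by (intro add_mono unorm_le_operator_norm[OF A] unorm_le_operator_norm[OF B])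
    finally show ?thesis
      by (simp add: algebra_simps)
  qed
  have "vector_space_pair sa sb"
    using A by (simp add: bounded_operator_def vector_space_pair_def Vector_Spaces.linear_iff)
  from vector_space_pair.linear_compose_sub[OF this, of A B]
  have "Vector_Spaces.linear sa sb (\<lambda>x. A x - B x)"
    using A B by (simp add: bounded_operator_def)
  then show "bounded_operator sa sb (\<lambda>x. A x - B x)"
    using bound by (auto simp: bounded_operator_def)
  show "operator_norm (\<lambda>x. A x - B x) \<le> operator_norm A + operator_norm B"
    using bound operator_norm_nonneg[OF A] operator_norm_nonneg[OF B]
    by (intro operator_norm_le) auto
qed

lemma add_powr_le_powr_add:
  fixes a b v :: real
  assumes "0 \<le> a" and "0 \<le> b" and "1 \<le> v"
  shows "a powr v + b powr v \<le> (a + b) powr v"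
proof -
  have split: "x powr v = x * x powr (v - 1)" if "0 \<le> x" for x :: real
    using that assms(3) by (cases "x = 0") (auto simp: powr_diff)
  have "a powr v + b powr v \<le> a * (a + b) powr (v - 1) + b * (a + b) powr (v - 1)"
    using assms by (auto simp: split intro!: add_mono mult_left_mono powr_mono2)
  also have "\<dots> = (a + b) powr v"
    using assms by (simp add: split algebra_simps)
  finally show ?thesis .
qed

text \<open>The \<open>v\<close>-th power of the quantity whose infimum over all representations is \<open>\<nu>\<^sub>v\<close>.\<close>

definition rep_sum :: "real \<Rightarrow> (nat \<Rightarrow> 'h::ultranormed_group \<Rightarrow> 'k::nonarch_field) \<Rightarrow> (nat \<Rightarrow> 'h) \<Rightarrow> real" where
  "rep_sum v a y = (\<Sum>n. operator_norm (a n) powr v * unorm (y n) powr v)"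

lemma rep_sum_nonneg:
  "nuclear_rep smul v a y A \<Longrightarrow> 0 \<le> rep_sum v a y"
  unfolding rep_sum_def nuclear_rep_def by (intro suminf_nonneg) auto

text \<open>The value \<open>A x\<close> is the sum of a series in an ultrametric space, hence no larger than the
  largest term; and a single term of a series of nonnegative reals is at most the sum.\<close>

lemma operator_norm_le_rep_sum:
  fixes smul :: "'k::nonarch_field \<Rightarrow> 'h::{ultranormed_group, complete_space} \<Rightarrow> 'h"
  assumes "nonarch_banach_space smul" and "1 \<le> v" and rep: "nuclear_rep smul v a y A"
  shows "operator_norm A \<le> rep_sum v a y powr (1 / v)"
proof (rule operator_norm_le)
  interpret nonarch_banach_space smul by fact
  fix x
  have a: "bounded_operator smul (*) (a n)" for n
    using rep by (simp add: nuclear_rep_def)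
  have term_le: "operator_norm (a n) * unorm (y n) \<le> rep_sum v a y powr (1 / v)" for n
  proof -
    have "(operator_norm (a n) * unorm (y n)) powr v = operator_norm (a n) powr v * unorm (y n) powr v"
      using operator_norm_nonneg[OF a] by (simp add: powr_mult)
    also have "\<dots> \<le> rep_sum v a y"
      using sum_le_suminf[of "\<lambda>n. operator_norm (a n) powr v * unorm (y n) powr v" "{n}"] rep
      by (simp add: rep_sum_def nuclear_rep_def)
    finally have "((operator_norm (a n) * unorm (y n)) powr v) powr (1 / v) \<le> rep_sum v a y powr (1 / v)"
      using assms(2) by (intro powr_mono2) auto
    then show ?thesis
      using assms(2) operator_norm_nonneg[OF a] by (simp add: powr_powr)
  qed
  show "unorm (A x) \<le> rep_sum v a y powr (1 / v) * unorm x"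
  proof (rule unorm_sums_le)
    show "(\<lambda>n. smul (a n x) (y n)) sums A x"
      using rep by (simp add: nuclear_rep_def)
    fix n
    have "unorm (smul (a n x) (y n)) \<le> (operator_norm (a n) * unorm x) * unorm (y n)"
      by (simp add: unorm_smul unorm_le_operator_norm[OF a] mult_right_mono)
    also have "\<dots> = (operator_norm (a n) * unorm (y n)) * unorm x"
      by simp
    also have "\<dots> \<le> rep_sum v a y powr (1 / v) * unorm x"
      by (intro mult_right_mono term_le) simp
    finally show "unorm (smul (a n x) (y n)) \<le> rep_sum v a y powr (1 / v) * unorm x" .
  qed
qed simp

text \<open>A representation of \<open>A - B\<close> is obtained by interleaving one of \<open>A\<close> with one of \<open>B\<close>
  in which the vectors have changed sign.\<close>

lemma nuclear_rep_diff:
  fixes smul :: "'k::nonarch_field \<Rightarrow> 'h::{ultranormed_group, complete_space} \<Rightarrow> 'h"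
  assumes "nonarch_banach_space smul"
    and A: "nuclear_rep smul v a y A" and B: "nuclear_rep smul v b z B"
  obtains c u where "nuclear_rep smul v c u (A - B)" "rep_sum v c u = rep_sum v a y + rep_sum v b z"
proof -
  interpret nonarch_banach_space smul by fact
  define c where "c n = (if even n then a (n div 2) else b (n div 2))" for n :: nat
  define u where "u n = (if even n then y (n div 2) else - z (n div 2))" for n :: nat
  have "(\<lambda>n. if even n then operator_norm (a (n div 2)) powr v * unorm (y (n div 2)) powr v
          else operator_norm (b (n div 2)) powr v * unorm (z (n div 2)) powr v)
        sums (rep_sum v a y + rep_sum v b z)"
    unfolding rep_sum_def
    by (rule sums_interleave) (use A B in \<open>auto simp: nuclear_rep_def intro: summable_sums\<close>)
  moreover have "(if even n then operator_norm (a (n div 2)) powr v * unorm (y (n div 2)) powr v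
          else operator_norm (b (n div 2)) powr v * unorm (z (n div 2)) powr v)
        = operator_norm (c n) powr v * unorm (u n) powr v" for n
    by (simp add: c_def u_def)
  ultimately have sums: "(\<lambda>n. operator_norm (c n) powr v * unorm (u n) powr v)
      sums (rep_sum v a y + rep_sum v b z)"
    by simp
  have "(\<lambda>n. smul (c n x) (u n)) sums ((A - B) x)" for x
  proof -
    have "(\<lambda>n. if even n then smul (a (n div 2) x) (y (n div 2)) else - smul (b (n div 2) x) (z (n div 2)))
        sums (A x + - B x)"
      by (rule sums_interleave[OF _ sums_uminus]) (use A B in \<open>auto simp: nuclear_rep_def\<close>)
    moreover have "(if even n then smul (a (n div 2) x) (y (n div 2)) else - smul (b (n div 2) x) (z (n div 2)))
        = smul (c n x) (u n)" for n
      by (simp add: c_def u_def)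
    ultimately show ?thesis
      by simp
  qed
  then have "nuclear_rep smul v c u (A - B)"
    using A B sums by (auto simp: nuclear_rep_def c_def sums_iff)
  moreover have "rep_sum v c u = rep_sum v a y + rep_sum v b z"
    using sums by (simp add: rep_sum_def sums_iff)
  ultimately show ?thesis
    by (rule that)
qed

lemma Lv_norm_finite:
  "v \<noteq> \<infinity> \<Longrightarrow> Lv_norm smul v A =
     Inf {rep_sum (enn2real v) a y powr (1 / enn2real v) | a y. nuclear_rep smul (enn2real v) a y A}"
  by (simp add: Lv_norm_def rep_sum_def)

lemma Lv_norm_le:
  assumes "v \<noteq> \<infinity>" and "nuclear_rep smul (enn2real v) a y A"
  shows "Lv_norm smul v A \<le> rep_sum (enn2real v) a y powr (1 / enn2real v)"
  unfolding Lv_norm_finite[OF assms(1)]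
  by (intro cInf_lower bdd_belowI[of _ 0]) (use assms(2) in auto)

lemma Lv_norm_greatest:
  assumes "v \<noteq> \<infinity>" and "A \<in> Lv_space smul v"
    and "\<And>a y. nuclear_rep smul (enn2real v) a y A \<Longrightarrow> B \<le> rep_sum (enn2real v) a y powr (1 / enn2real v)"
  shows "B \<le> Lv_norm smul v A"
  unfolding Lv_norm_finite[OF assms(1)]
  by (intro cInf_greatest) (use assms in \<open>auto simp: Lv_space_def\<close>)

lemma enn2real_ge_1: "1 \<le> v \<Longrightarrow> v \<noteq> \<infinity> \<Longrightarrow> 1 \<le> enn2real v"
  by (cases v) (auto simp: ennreal_le_iff2 simp flip: ennreal_1)

text \<open>The one fact about \<open>\<nu>\<^sub>v\<close> on which the estimates of the integral rest.\<close>

lemma operator_norm_le_Lv_norm: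
  fixes smul :: "'k::nonarch_field \<Rightarrow> 'h::{ultranormed_group, complete_space} \<Rightarrow> 'h"
  assumes "nonarch_banach_space smul" and "1 \<le> v" and "A \<in> Lv_space smul v"
  shows "operator_norm A \<le> Lv_norm smul v A"
proof (cases "v = \<infinity>")
  case True
  then show ?thesis
    by (simp add: Lv_norm_def)
next
  case False
  then show ?thesis
    using assms by (intro Lv_norm_greatest operator_norm_le_rep_sum enn2real_ge_1)
qed

text \<open>The triangle inequality for \<open>\<nu>\<^sub>v\<close>: interleaving adds the \<open>v\<close>-th powers \<open>\<alpha>\<^sup>v\<close> and \<open>\<beta>\<^sup>v\<close> of the values of
  two representations, and \<open>\<alpha>\<^sup>v + \<beta>\<^sup>v \<le> (\<alpha> + \<beta>)\<^sup>v\<close> for \<open>v \<ge> 1\<close>.\<close>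

lemma normed_carrier_Lv:
  fixes smul :: "'k::nonarch_field \<Rightarrow> 'h::{ultranormed_group, complete_space} \<Rightarrow> 'h"
  assumes smul: "nonarch_banach_space smul" and v: "1 \<le> v"
  shows "normed_carrier (Lv_space smul v) (Lv_norm smul v)"
proof -
  interpret nonarch_banach_space smul by fact
  let ?v = "enn2real v"
  have vs: "vector_space smul" "vector_space ((*) :: 'k \<Rightarrow> 'k \<Rightarrow> 'k)"
    by unfold_locales (simp_all add: algebra_simps)
  have zero_rep: "nuclear_rep smul ?v (\<lambda>_ _. 0) (\<lambda>_. 0) 0" if "v \<noteq> \<infinity>"
    by (simp add: nuclear_rep_def bounded_operator_zero[OF vs])
  have bounded: "bounded_operator smul smul A" if "A \<in> Lv_space smul v" for A
    using that by (simp add: Lv_space_def)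
  show ?thesis
  proof
    show zero: "0 \<in> Lv_space smul v"
      using zero_rep bounded_operator_zero[OF vs(1) vs(1)] by (auto simp: Lv_space_def zero_fun_def)
    show nonneg: "0 \<le> Lv_norm smul v A" if "A \<in> Lv_space smul v" for A
      using operator_norm_le_Lv_norm[OF smul v that] operator_norm_nonneg[OF bounded[OF that]]
      by linarith
    show "Lv_norm smul v 0 = 0"
    proof (cases "v = \<infinity>")
      case True
      then show ?thesis
        by (simp add: Lv_norm_def zero_fun_def)
    next
      case False
      then show ?thesis
        using Lv_norm_le[OF False zero_rep[OF False]] nonneg[OF zero] by (simp add: rep_sum_def)
    qed
  next
    fix A B assume A: "A \<in> Lv_space smul v" and B: "B \<in> Lv_space smul v"
    note diff = bounded_operator_diff[OF bounded[OF A] bounded[OF B]]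
    show "A - B \<in> Lv_space smul v"
    proof (cases "v = \<infinity>")
      case True
      then show ?thesis
        using diff by (simp add: Lv_space_def fun_diff_def)
    next
      case False
      then obtain a y b z where "nuclear_rep smul ?v a y A" "nuclear_rep smul ?v b z B"
        using A B by (auto simp: Lv_space_def)
      then obtain c u where "nuclear_rep smul ?v c u (A - B)"
        using nuclear_rep_diff[OF smul] by blast
      then show ?thesis
        using diff by (auto simp: Lv_space_def fun_diff_def)
    qed
    show "Lv_norm smul v (A - B) \<le> Lv_norm smul v A + Lv_norm smul v B"
    proof (cases "v = \<infinity>")
      case True
      then show ?thesis
        using diff by (simp add: Lv_norm_def fun_diff_def)
    next
      case False
      then have v1: "1 \<le> ?v"
        using v by (intro enn2real_ge_1)
      have le: "Lv_norm smul v (A - B) \<le> rep_sum ?v a y powr (1 / ?v) + rep_sum ?v b z powr (1 / ?v)"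
        if a: "nuclear_rep smul ?v a y A" and b: "nuclear_rep smul ?v b z B" for a y b z
      proof -
        obtain c u where cu: "nuclear_rep smul ?v c u (A - B)" "rep_sum ?v c u = rep_sum ?v a y + rep_sum ?v b z"
          using nuclear_rep_diff[OF smul a b] .
        define \<alpha> where "\<alpha> = rep_sum ?v a y powr (1 / ?v)"
        define \<beta> where "\<beta> = rep_sum ?v b z powr (1 / ?v)"
        have "rep_sum ?v c u = \<alpha> powr ?v + \<beta> powr ?v"
          using v1 rep_sum_nonneg[OF a] rep_sum_nonneg[OF b] by (simp add: cu \<alpha>_def \<beta>_def powr_powr)
        also have "\<dots> \<le> (\<alpha> + \<beta>) powr ?v"
          using v1 by (intro add_powr_le_powr_add) (auto simp: \<alpha>_def \<beta>_def)
        finally have "rep_sum ?v c u powr (1 / ?v) \<le> ((\<alpha> + \<beta>) powr ?v) powr (1 / ?v)"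
          using v1 rep_sum_nonneg[OF cu(1)] by (intro powr_mono2) auto
        also have "\<dots> = \<alpha> + \<beta>"
          using v1 by (simp add: powr_powr \<alpha>_def \<beta>_def)
        finally show ?thesis
          using Lv_norm_le[OF False cu(1)] by (simp add: \<alpha>_def \<beta>_def)
      qed
      \<comment> \<open>The two infima are taken one after the other.\<close>
      have "Lv_norm smul v (A - B) - rep_sum ?v a y powr (1 / ?v) \<le> Lv_norm smul v B"
        if "nuclear_rep smul ?v a y A" for a y
        using le[OF that] by (intro Lv_norm_greatest False B) (simp add: algebra_simps)
      then have "Lv_norm smul v (A - B) - Lv_norm smul v B \<le> Lv_norm smul v A"
        by (intro Lv_norm_greatest False A) (simp add: algebra_simps)
      then show ?thesis
        by simp
    qed
  qed
qed

section \<open>Minkowski's and Hoelder's inequalities for the norms of \<open>L\<^sup>s\<close>\<close>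

text \<open>An upper bound on the norm of \<open>L\<^sup>s\<close> stated without the \<open>s\<close>-th root and without distinguishing infinite
  integrals. The inequalities below are proved in this form and with positive bounds, so that
  functions can be divided by the bounds of their norms.\<close>

definition Ls_le :: "'w measure \<Rightarrow> ennreal \<Rightarrow> ('w \<Rightarrow> real) \<Rightarrow> real \<Rightarrow> bool" where
  "Ls_le M s u A \<longleftrightarrow> (if s = \<infinity> then AE \<omega> in M. u \<omega> \<le> A
     else (\<integral>\<^sup>+ \<omega>. ennreal (u \<omega> powr enn2real s) \<partial>M) \<le> ennreal (A powr enn2real s))"

lemma Ls_norm_le_iff:
  assumes "(\<lambda>\<omega>. N (f \<omega>)) \<in> borel_measurable M" and "0 \<le> A" and "1 \<le> s"
  shows "Ls_norm M s N f \<le> ennreal A \<longleftrightarrow> Ls_le M s (\<lambda>\<omega>. N (f \<omega>)) A"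
proof (cases "s = \<infinity>")
  case True
  have "esssup M (\<lambda>\<omega>. ennreal (N (f \<omega>))) \<le> ennreal A \<longleftrightarrow> (AE \<omega> in M. ennreal (N (f \<omega>)) \<le> ennreal A)"
  proof
    assume le: "esssup M (\<lambda>\<omega>. ennreal (N (f \<omega>))) \<le> ennreal A"
    have "AE \<omega> in M. ennreal (N (f \<omega>)) \<le> esssup M (\<lambda>\<omega>. ennreal (N (f \<omega>)))"
      by (rule esssup_AE)
    then show "AE \<omega> in M. ennreal (N (f \<omega>)) \<le> ennreal A"
      by (rule AE_mp) (use le in \<open>auto intro: order_trans\<close>)
  next
    assume "AE \<omega> in M. ennreal (N (f \<omega>)) \<le> ennreal A"
    then show "esssup M (\<lambda>\<omega>. ennreal (N (f \<omega>))) \<le> ennreal A"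
      using assms(1) by (intro esssup_I) auto
  qed
  then show ?thesis
    using True assms(2) by (simp add: Ls_norm_def Ls_le_def ennreal_le_iff)
next
  case False
  define \<sigma> where "\<sigma> = enn2real s"
  have \<sigma>: "1 \<le> \<sigma>"
    using assms(3) False by (simp add: \<sigma>_def enn2real_ge_1)
  define I where "I = (\<integral>\<^sup>+ \<omega>. ennreal (N (f \<omega>) powr \<sigma>) \<partial>M)"
  have norm: "Ls_norm M s N f = (if I = \<infinity> then \<infinity> else ennreal (enn2real I powr (1 / \<sigma>)))"
    using False by (simp add: Ls_norm_def I_def \<sigma>_def)
  show ?thesis
  proof (cases I)
    case (real i)
    have "i powr (1 / \<sigma>) \<le> A \<longleftrightarrow> i \<le> A powr \<sigma>"
    proof
      assume "i powr (1 / \<sigma>) \<le> A"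
      then have "(i powr (1 / \<sigma>)) powr \<sigma> \<le> A powr \<sigma>"
        using \<sigma> by (intro powr_mono2) auto
      then show "i \<le> A powr \<sigma>"
        using \<sigma> real by (simp add: powr_powr)
    next
      assume "i \<le> A powr \<sigma>"
      then have "i powr (1 / \<sigma>) \<le> (A powr \<sigma>) powr (1 / \<sigma>)"
        using \<sigma> real by (intro powr_mono2) auto
      then show "i powr (1 / \<sigma>) \<le> A"
        using \<sigma> assms(2) by (simp add: powr_powr)
    qed
    moreover have "Ls_le M s (\<lambda>\<omega>. N (f \<omega>)) A \<longleftrightarrow> I \<le> ennreal (A powr \<sigma>)"
      using False by (simp add: Ls_le_def I_def \<sigma>_def)
    ultimately show ?thesis
      using assms(2) real by (simp add: norm ennreal_le_iff)
  next
    case top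
    moreover have "Ls_le M s (\<lambda>\<omega>. N (f \<omega>)) A \<longleftrightarrow> I \<le> ennreal (A powr \<sigma>)"
      using False by (simp add: Ls_le_def I_def \<sigma>_def)
    ultimately show ?thesis
      by (simp add: norm top_unique)
  qed
qed

text \<open>The order of the premises lets an estimate of \<open>w\<close> and a pointwise comparison be chained directly.\<close>

lemma Ls_le_mono:
  assumes w: "Ls_le M s w A" and le: "\<And>\<omega>. \<omega> \<in> space M \<Longrightarrow> u \<omega> \<le> w \<omega>"
    and nonneg: "\<And>\<omega>. \<omega> \<in> space M \<Longrightarrow> 0 \<le> u \<omega>" and "1 \<le> s" and "0 \<le> A" and "A \<le> B"
  shows "Ls_le M s u B"
proof (cases "s = \<infinity>")
  case True
  have "AE \<omega> in M. u \<omega> \<le> w \<omega>"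
    using le by auto
  moreover have "AE \<omega> in M. w \<omega> \<le> A"
    using w True by (simp add: Ls_le_def)
  ultimately have "AE \<omega> in M. u \<omega> \<le> B"
    by eventually_elim (use \<open>A \<le> B\<close> in linarith)
  then show ?thesis
    using True by (simp add: Ls_le_def)
next
  case False
  then have s: "1 \<le> enn2real s"
    using \<open>1 \<le> s\<close> by (intro enn2real_ge_1)
  have "(\<integral>\<^sup>+ \<omega>. ennreal (u \<omega> powr enn2real s) \<partial>M) \<le> (\<integral>\<^sup>+ \<omega>. ennreal (w \<omega> powr enn2real s) \<partial>M)"
    using le nonneg s by (intro nn_integral_mono ennreal_leI powr_mono2) auto
  also have "\<dots> \<le> ennreal (A powr enn2real s)"
    using w False by (simp add: Ls_le_def)
  also have "\<dots> \<le> ennreal (B powr enn2real s)"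
    using \<open>0 \<le> A\<close> \<open>A \<le> B\<close> s by (intro ennreal_leI powr_mono2) auto
  finally show ?thesis
    using False by (simp add: Ls_le_def)
qed

lemma nn_integral_le_combination:
  fixes f g h :: "'w \<Rightarrow> real"
  assumes [measurable]: "g \<in> borel_measurable M" "h \<in> borel_measurable M"
    and "\<And>\<omega>. 0 \<le> g \<omega>" "\<And>\<omega>. 0 \<le> h \<omega>" "0 \<le> c" "0 \<le> d" "0 \<le> a" "0 \<le> b"
    and le: "AE \<omega> in M. f \<omega> \<le> c * g \<omega> + d * h \<omega>"
    and g: "(\<integral>\<^sup>+ \<omega>. ennreal (g \<omega>) \<partial>M) \<le> ennreal a"
    and h: "(\<integral>\<^sup>+ \<omega>. ennreal (h \<omega>) \<partial>M) \<le> ennreal b"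
  shows "(\<integral>\<^sup>+ \<omega>. ennreal (f \<omega>) \<partial>M) \<le> ennreal (c * a + d * b)"
proof -
  have "(\<integral>\<^sup>+ \<omega>. ennreal (f \<omega>) \<partial>M) \<le> (\<integral>\<^sup>+ \<omega>. ennreal c * ennreal (g \<omega>) + ennreal d * ennreal (h \<omega>) \<partial>M)"
  proof (rule nn_integral_mono_AE, rule AE_mp[OF le], intro AE_I2 impI)
    fix \<omega> assume "f \<omega> \<le> c * g \<omega> + d * h \<omega>"
    then have "ennreal (f \<omega>) \<le> ennreal (c * g \<omega> + d * h \<omega>)"
      by (rule ennreal_leI)
    then show "ennreal (f \<omega>) \<le> ennreal c * ennreal (g \<omega>) + ennreal d * ennreal (h \<omega>)"
      using assms by (simp add: ennreal_plus ennreal_mult)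
  qed
  also have "\<dots> = ennreal c * (\<integral>\<^sup>+ \<omega>. ennreal (g \<omega>) \<partial>M) + ennreal d * (\<integral>\<^sup>+ \<omega>. ennreal (h \<omega>) \<partial>M)"
    by (simp add: nn_integral_add nn_integral_cmult)
  also have "\<dots> \<le> ennreal c * ennreal a + ennreal d * ennreal b"
    using g h by (intro add_mono mult_left_mono) auto
  finally show ?thesis
    using assms by (simp add: ennreal_plus ennreal_mult)
qed

text \<open>Convexity of \<open>x \<mapsto> x\<^sup>s\<close> including the end point \<open>x = 0\<close>.\<close>

lemma powr_convex_nonneg:
  fixes x y s t :: real
  assumes "1 \<le> s" "0 \<le> x" "0 \<le> y" "0 \<le> t" "t \<le> 1"
  shows "((1 - t) * x + t * y) powr s \<le> (1 - t) * x powr s + t * y powr s"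
proof -
  have contract: "(c * z) powr s \<le> c * z powr s" if "0 \<le> c" "c \<le> 1" "0 \<le> z" for c z :: real
  proof -
    have "c powr s \<le> c powr 1"
      by (rule powr_mono') (use that assms(1) in auto)
    then show ?thesis
      using that by (simp add: powr_mult mult_right_mono)
  qed
  show ?thesis
  proof (cases "x = 0 \<or> y = 0")
    case True
    then show ?thesis
      using contract[of t y] contract[of "1 - t" x] assms by auto
  next
    case False
    then show ?thesis
      using convex_onD[OF powr_convex[OF assms(1)], of t x y] assms by simp
  qed
qed

text \<open>Minkowski's inequality. If \<open>u\<close> and \<open>w\<close> have norm at most \<open>A\<close> and \<open>B\<close>, then
  \<open>(u + w) / (A + B)\<close> is a convex combination of \<open>u / A\<close> and \<open>w / B\<close>, with weights proportional to
  \<open>A\<close> and \<open>B\<close>, and \<open>x \<mapsto> x\<^sup>s\<close> is convex.\<close>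

lemma Ls_le_add:
  assumes [measurable]: "u \<in> borel_measurable M" "w \<in> borel_measurable M"
    and u0: "\<And>\<omega>. \<omega> \<in> space M \<Longrightarrow> 0 \<le> u \<omega>" and w0: "\<And>\<omega>. \<omega> \<in> space M \<Longrightarrow> 0 \<le> w \<omega>"
    and u: "Ls_le M s u A" and w: "Ls_le M s w B" and A: "0 < A" and B: "0 < B" and "1 \<le> s"
  shows "Ls_le M s (\<lambda>\<omega>. u \<omega> + w \<omega>) (A + B)"
proof (cases "s = \<infinity>")
  case True
  then have "AE \<omega> in M. u \<omega> \<le> A" "AE \<omega> in M. w \<omega> \<le> B"
    using u w by (simp_all add: Ls_le_def)
  then have "AE \<omega> in M. u \<omega> + w \<omega> \<le> A + B"
    by eventually_elim simp
  then show ?thesis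
    using True by (simp add: Ls_le_def)
next
  case False
  define \<sigma> where "\<sigma> = enn2real s"
  have \<sigma>: "1 \<le> \<sigma>"
    using \<open>1 \<le> s\<close> False by (simp add: \<sigma>_def enn2real_ge_1)
  define t where "t = B / (A + B)"
  have t: "0 \<le> t" "t \<le> 1" and AB: "(A + B) * (1 - t) = A" "(A + B) * t = B"
    using A B by (auto simp: t_def field_simps)
  have pos: "0 < A powr \<sigma>" "0 < B powr \<sigma>"
    using A B by auto
  let ?c = "(A + B) powr \<sigma> * (1 - t) / A powr \<sigma>"
  let ?d = "(A + B) powr \<sigma> * t / B powr \<sigma>"
  have "(\<integral>\<^sup>+ \<omega>. ennreal ((u \<omega> + w \<omega>) powr \<sigma>) \<partial>M) \<le> ennreal (?c * A powr \<sigma> + ?d * B powr \<sigma>)"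
  proof (rule nn_integral_le_combination)
    show "AE \<omega> in M. (u \<omega> + w \<omega>) powr \<sigma> \<le> ?c * u \<omega> powr \<sigma> + ?d * w \<omega> powr \<sigma>"
    proof (intro AE_I2)
      fix \<omega> assume \<omega>: "\<omega> \<in> space M"
      have "u \<omega> + w \<omega> = (A + B) * ((1 - t) * (u \<omega> / A) + t * (w \<omega> / B))"
        using A B by (simp add: distrib_left AB flip: mult.assoc)
      then have "(u \<omega> + w \<omega>) powr \<sigma> = (A + B) powr \<sigma> * ((1 - t) * (u \<omega> / A) + t * (w \<omega> / B)) powr \<sigma>"
        using A B t u0[OF \<omega>] w0[OF \<omega>] by (simp add: powr_mult)
      also have "\<dots> \<le> (A + B) powr \<sigma> * ((1 - t) * (u \<omega> / A) powr \<sigma> + t * (w \<omega> / B) powr \<sigma>)"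
        using A B t \<sigma> u0[OF \<omega>] w0[OF \<omega>] by (intro mult_left_mono powr_convex_nonneg) auto
      also have "\<dots> = ?c * u \<omega> powr \<sigma> + ?d * w \<omega> powr \<sigma>"
        using A B u0[OF \<omega>] w0[OF \<omega>] by (simp add: powr_divide algebra_simps)
      finally show "(u \<omega> + w \<omega>) powr \<sigma> \<le> ?c * u \<omega> powr \<sigma> + ?d * w \<omega> powr \<sigma>" .
    qed
    show "(\<integral>\<^sup>+ \<omega>. ennreal (u \<omega> powr \<sigma>) \<partial>M) \<le> ennreal (A powr \<sigma>)"
      "(\<integral>\<^sup>+ \<omega>. ennreal (w \<omega> powr \<sigma>) \<partial>M) \<le> ennreal (B powr \<sigma>)"
      using u w False by (simp_all add: Ls_le_def \<sigma>_def)
  qed (use t in simp_all)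
  also have "?c * A powr \<sigma> + ?d * B powr \<sigma> = (A + B) powr \<sigma>"
    using pos A B by (simp flip: distrib_left)
  finally show ?thesis
    using False by (simp add: Ls_le_def \<sigma>_def)
qed

lemma conjugate_exponent_cases:
  fixes q r s :: ennreal
  assumes "1 \<le> r" "1 \<le> q" "1 \<le> s" and sum: "1 / q + 1 / r = 1 / s"
  obtains (all_top) "q = \<infinity>" "r = \<infinity>" "s = \<infinity>"
    | (q_top) "q = \<infinity>" "r = s" "s \<noteq> \<infinity>"
    | (r_top) "r = \<infinity>" "q = s" "s \<noteq> \<infinity>"
    | (finite) "q \<noteq> \<infinity>" "r \<noteq> \<infinity>" "s \<noteq> \<infinity>" "1 / enn2real q + 1 / enn2real r = 1 / enn2real s"
proof -
  have inv: "1 / x = ennreal (1 / enn2real x)" "0 < 1 / enn2real x" if "1 \<le> x" "x \<noteq> \<infinity>" for x :: ennreal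
  proof -
    have "1 \<le> enn2real x" "x = ennreal (enn2real x)"
      using that by (auto simp: enn2real_ge_1 less_top)
    then show "1 / x = ennreal (1 / enn2real x)" "0 < 1 / enn2real x"
      using divide_ennreal[of 1 "enn2real x"] by auto
  qed
  have eq: "x = y" if "1 \<le> x" "x \<noteq> \<infinity>" "1 \<le> y" "y \<noteq> \<infinity>" "1 / x = 1 / y" for x y :: ennreal
  proof -
    have "1 / enn2real x = 1 / enn2real y"
      using that inv(2)[of x] inv(2)[of y] by (simp add: inv(1))
    then have "enn2real x = enn2real y"
      by simp
    then show ?thesis
      using that by (metis ennreal_enn2real_if infinity_ennreal_def)
  qed
  have ne: "1 / x \<noteq> 0" if "1 \<le> x" "x \<noteq> \<infinity>" for x :: ennreal
    using inv[OF that] by simp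
  have top: "1 / (\<infinity> :: ennreal) = 0"
    by simp
  consider "s = \<infinity>" | "s \<noteq> \<infinity>" "q = \<infinity>" "r \<noteq> \<infinity>" | "s \<noteq> \<infinity>" "r = \<infinity>" "q \<noteq> \<infinity>"
    | "s \<noteq> \<infinity>" "q = \<infinity>" "r = \<infinity>" | "q \<noteq> \<infinity>" "r \<noteq> \<infinity>" "s \<noteq> \<infinity>"
    by blast
  then show ?thesis
  proof cases
    case 1
    then have "1 / q = 0" "1 / r = 0"
      using sum top by auto
    then show ?thesis
      using ne assms all_top 1 by blast
  next
    case 2
    then show ?thesis
      using eq[of r s] assms top q_top by simp
  next
    case 3
    then show ?thesis
      using eq[of q s] assms top r_top by simp
  next
    case 4
    then show ?thesis
      using sum top ne[of s] assms by simp
  next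
    case 5
    have "ennreal (1 / enn2real q + 1 / enn2real r) = ennreal (1 / enn2real s)"
      using sum 5 assms inv(2)[of q] inv(2)[of r] by (simp add: inv(1) ennreal_plus)
    then have "1 / enn2real q + 1 / enn2real r = 1 / enn2real s"
      using 5 assms inv(2)[of q] inv(2)[of r] inv(2)[of s] by (subst (asm) ennreal_inj) auto
    then show ?thesis
      using finite 5 by blast
  qed
qed

text \<open>Hoelder's inequality, from Young's inequality for the normalised functions \<open>u / A\<close> and
  \<open>w / B\<close>: the weights \<open>s / r\<close> and \<open>s / q\<close> add up to one.\<close>

lemma Ls_le_mult:
  assumes [measurable]: "u \<in> borel_measurable M" "w \<in> borel_measurable M"
    and u0: "\<And>\<omega>. \<omega> \<in> space M \<Longrightarrow> 0 \<le> u \<omega>" and w0: "\<And>\<omega>. \<omega> \<in> space M \<Longrightarrow> 0 \<le> w \<omega>"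
    and u: "Ls_le M r u A" and w: "Ls_le M q w B" and A: "0 < A" and B: "0 < B"
    and rqs: "1 \<le> r" "1 \<le> q" "1 \<le> s" "1 / q + 1 / r = 1 / s"
  shows "Ls_le M s (\<lambda>\<omega>. u \<omega> * w \<omega>) (A * B)"
  using rqs
proof (cases rule: conjugate_exponent_cases)
  case all_top
  then have "AE \<omega> in M. u \<omega> \<le> A" "AE \<omega> in M. w \<omega> \<le> B"
    using u w by (simp_all add: Ls_le_def)
  moreover have "AE \<omega> in M. 0 \<le> w \<omega>"
    using w0 by auto
  ultimately have "AE \<omega> in M. u \<omega> * w \<omega> \<le> A * B"
    by eventually_elim (use A in \<open>auto intro: mult_mono\<close>)
  then show ?thesis
    using all_top by (simp add: Ls_le_def)
next
  case q_top
  let ?s = "enn2real s"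
  have s: "1 \<le> ?s"
    using q_top rqs by (simp add: enn2real_ge_1)
  have "AE \<omega> in M. w \<omega> \<le> B"
    using q_top w by (simp add: Ls_le_def)
  moreover have "AE \<omega> in M. 0 \<le> u \<omega> \<and> 0 \<le> w \<omega>"
    using u0 w0 by auto
  ultimately have "AE \<omega> in M. (u \<omega> * w \<omega>) powr ?s \<le> B powr ?s * u \<omega> powr ?s + 0 * 0"
  proof eventually_elim
    case (elim \<omega>)
    then show ?case
      using s by (simp add: powr_mult mult.commute[of "B powr ?s"] mult_left_mono powr_mono2)
  qed
  then have "(\<integral>\<^sup>+ \<omega>. ennreal ((u \<omega> * w \<omega>) powr ?s) \<partial>M) \<le> ennreal (B powr ?s * A powr ?s + 0 * 0)"
    using q_top u by (intro nn_integral_le_combination[where h = "\<lambda>_. 0"]) (auto simp: Ls_le_def)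
  then show ?thesis
    using q_top A B by (simp add: Ls_le_def powr_mult mult.commute)
next
  case r_top
  let ?s = "enn2real s"
  have s: "1 \<le> ?s"
    using r_top rqs by (simp add: enn2real_ge_1)
  have "AE \<omega> in M. u \<omega> \<le> A"
    using r_top u by (simp add: Ls_le_def)
  moreover have "AE \<omega> in M. 0 \<le> u \<omega> \<and> 0 \<le> w \<omega>"
    using u0 w0 by auto
  ultimately have "AE \<omega> in M. (u \<omega> * w \<omega>) powr ?s \<le> A powr ?s * w \<omega> powr ?s + 0 * 0"
  proof eventually_elim
    case (elim \<omega>)
    then show ?case
      using s by (simp add: powr_mult mult_right_mono powr_mono2)
  qed
  then have "(\<integral>\<^sup>+ \<omega>. ennreal ((u \<omega> * w \<omega>) powr ?s) \<partial>M) \<le> ennreal (A powr ?s * B powr ?s + 0 * 0)"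
    using r_top w by (intro nn_integral_le_combination[where h = "\<lambda>_. 0"]) (auto simp: Ls_le_def)
  then show ?thesis
    using r_top A B by (simp add: Ls_le_def powr_mult)
next
  case finite
  define \<rho> \<kappa> \<sigma> where defs: "\<rho> = enn2real r" "\<kappa> = enn2real q" "\<sigma> = enn2real s"
  have ge1: "1 \<le> \<rho>" "1 \<le> \<kappa>" "1 \<le> \<sigma>"
    using finite rqs by (auto simp: defs enn2real_ge_1)
  have weights: "\<sigma> / \<rho> + \<sigma> / \<kappa> = 1"
  proof -
    have "\<sigma> / \<rho> + \<sigma> / \<kappa> = \<sigma> * (1 / \<kappa> + 1 / \<rho>)"
      by (simp add: algebra_simps)
    then show ?thesis
      using finite(4) ge1 by (simp add: defs)
  qed
  let ?c = "(A * B) powr \<sigma> * (\<sigma> / \<rho>) / A powr \<rho>"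
  let ?d = "(A * B) powr \<sigma> * (\<sigma> / \<kappa>) / B powr \<kappa>"
  have "(\<integral>\<^sup>+ \<omega>. ennreal ((u \<omega> * w \<omega>) powr \<sigma>) \<partial>M) \<le> ennreal (?c * A powr \<rho> + ?d * B powr \<kappa>)"
  proof (rule nn_integral_le_combination)
    show "AE \<omega> in M. (u \<omega> * w \<omega>) powr \<sigma> \<le> ?c * u \<omega> powr \<rho> + ?d * w \<omega> powr \<kappa>"
    proof (intro AE_I2)
      fix \<omega> assume "\<omega> \<in> space M"
      then have nonneg: "0 \<le> u \<omega>" "0 \<le> w \<omega>"
        using u0 w0 by auto
      show "(u \<omega> * w \<omega>) powr \<sigma> \<le> ?c * u \<omega> powr \<rho> + ?d * w \<omega> powr \<kappa>"
      proof (cases "u \<omega> = 0 \<or> w \<omega> = 0")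
        case True
        then show ?thesis
          using ge1 by auto
      next
        case False
        then have pos: "0 < u \<omega> / A" "0 < w \<omega> / B"
          using nonneg A B by auto
        have "(u \<omega> * w \<omega>) powr \<sigma> = (A * B) powr \<sigma> * ((u \<omega> / A) powr \<sigma> * (w \<omega> / B) powr \<sigma>)"
          using pos A B nonneg by (simp add: powr_mult powr_divide)
        also have "(u \<omega> / A) powr \<sigma> * (w \<omega> / B) powr \<sigma>
            = ((u \<omega> / A) powr \<rho>) powr (\<sigma> / \<rho>) * ((w \<omega> / B) powr \<kappa>) powr (\<sigma> / \<kappa>)"
          using ge1 by (simp add: powr_powr)
        also have "\<dots> \<le> \<sigma> / \<rho> * (u \<omega> / A) powr \<rho> + \<sigma> / \<kappa> * (w \<omega> / B) powr \<kappa>"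
          using ge1 weights pos by (intro Youngs_inequality_0) auto
        finally have "(u \<omega> * w \<omega>) powr \<sigma>
            \<le> (A * B) powr \<sigma> * (\<sigma> / \<rho> * (u \<omega> / A) powr \<rho> + \<sigma> / \<kappa> * (w \<omega> / B) powr \<kappa>)"
          by (simp add: mult_left_mono)
        then show ?thesis
          using A B nonneg by (simp add: powr_divide distrib_left)
      qed
    qed
    show "(\<integral>\<^sup>+ \<omega>. ennreal (u \<omega> powr \<rho>) \<partial>M) \<le> ennreal (A powr \<rho>)"
      "(\<integral>\<^sup>+ \<omega>. ennreal (w \<omega> powr \<kappa>) \<partial>M) \<le> ennreal (B powr \<kappa>)"
      using u w finite by (simp_all add: Ls_le_def defs)
  qed (use ge1 in simp_all)
  also have "?c * A powr \<rho> + ?d * B powr \<kappa> = (A * B) powr \<sigma> * (\<sigma> / \<rho> + \<sigma> / \<kappa>)"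
    using A B by (simp add: distrib_left)
  finally show ?thesis
    using finite weights by (simp add: Ls_le_def defs)
qed

section \<open>Strongly measurable functions\<close>

definition strongly_measurable ::
    "'w measure \<Rightarrow> 'x::ab_group_add set \<Rightarrow> ('x \<Rightarrow> real) \<Rightarrow> ('w \<Rightarrow> 'x) \<Rightarrow> bool" where
  "strongly_measurable M X N f \<longleftrightarrow> (\<forall>\<omega>\<in>space M. f \<omega> \<in> X) \<and>
     (\<exists>G. (\<forall>n. simple_into M X (G n)) \<and> (\<forall>\<omega>\<in>space M. (\<lambda>n. N (G n \<omega> - f \<omega>)) \<longlonglongrightarrow> 0))"

lemma Ls_space_iff:
  "f \<in> Ls_space M s X N \<longleftrightarrow> strongly_measurable M X N f \<and>
     (\<exists>F. (\<forall>n. simple_into M X (F n)) \<and> (\<lambda>n. Ls_norm M s N (F n - f)) \<longlonglongrightarrow> 0)"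
  by (auto simp: Ls_space_def strongly_measurable_def)

lemma simple_into_compose2:
  assumes "simple_into M X f" and "simple_into M Y g" and "\<And>x y. x \<in> X \<Longrightarrow> y \<in> Y \<Longrightarrow> b x y \<in> W"
  shows "simple_into M W (\<lambda>\<omega>. b (f \<omega>) (g \<omega>))"
  using assms by (auto simp: simple_into_def image_subset_iff intro: simple_function_compose2)

context normed_carrier
begin

lemma tendsto_norm:
  assumes "(\<lambda>n. N (x n - l)) \<longlonglongrightarrow> 0" and "\<And>n. x n \<in> Z" and "l \<in> Z"
  shows "(\<lambda>n. N (x n)) \<longlonglongrightarrow> N l"
proof -
  have "(\<lambda>n. N (x n) - N l) \<longlonglongrightarrow> 0"
    by (rule Lim_null_comparison[OF _ assms(1)]) (simp add: abs_norm_diff_le assms)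
  then show ?thesis
    by (rule LIM_zero_cancel)
qed

lemma strongly_measurable_simple:
  assumes "simple_into M Z f"
  shows "strongly_measurable M Z N f"
  unfolding strongly_measurable_def
proof (intro conjI exI[of _ "\<lambda>_. f"])
  show "\<forall>\<omega>\<in>space M. f \<omega> \<in> Z"
    using assms by (auto simp: simple_into_def)
qed (use assms in \<open>auto simp: norm_zero\<close>)

lemma strongly_measurable_diff:
  assumes "strongly_measurable M Z N f" and "strongly_measurable M Z N g"
  shows "strongly_measurable M Z N (f - g)"
proof -
  obtain F where F: "\<And>n. simple_into M Z (F n)" "\<And>\<omega>. \<omega> \<in> space M \<Longrightarrow> (\<lambda>n. N (F n \<omega> - f \<omega>)) \<longlonglongrightarrow> 0"
    using assms(1) unfolding strongly_measurable_def by blast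
  obtain G where G: "\<And>n. simple_into M Z (G n)" "\<And>\<omega>. \<omega> \<in> space M \<Longrightarrow> (\<lambda>n. N (G n \<omega> - g \<omega>)) \<longlonglongrightarrow> 0"
    using assms(2) unfolding strongly_measurable_def by blast
  have mem: "f \<omega> \<in> Z" "g \<omega> \<in> Z" "F n \<omega> \<in> Z" "G n \<omega> \<in> Z" if "\<omega> \<in> space M" for \<omega> n
    using assms F(1)[of n] G(1)[of n] that by (auto simp: strongly_measurable_def simple_into_def)
  have "simple_into M Z (\<lambda>\<omega>. F n \<omega> - G n \<omega>)" for n
    by (rule simple_into_compose2[OF F(1) G(1)]) (rule diff_mem)
  moreover have "(\<lambda>n. N ((F n \<omega> - G n \<omega>) - (f \<omega> - g \<omega>))) \<longlonglongrightarrow> 0" if \<omega>: "\<omega> \<in> space M" for \<omega>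
  proof (rule Lim_null_comparison[OF always_eventually, OF allI])
    fix n
    have eq: "F n \<omega> - G n \<omega> - (f \<omega> - g \<omega>) = (F n \<omega> - f \<omega>) - (G n \<omega> - g \<omega>)"
      by simp
    have "N (F n \<omega> - G n \<omega> - (f \<omega> - g \<omega>)) \<le> N (F n \<omega> - f \<omega>) + N (G n \<omega> - g \<omega>)"
      unfolding eq using mem[OF \<omega>] by (intro norm_diff_le diff_mem)
    then show "norm (N (F n \<omega> - G n \<omega> - (f \<omega> - g \<omega>))) \<le> N (F n \<omega> - f \<omega>) + N (G n \<omega> - g \<omega>)"
      using mem[OF \<omega>] by (simp add: norm_nonneg diff_mem)
  next
    show "(\<lambda>n. N (F n \<omega> - f \<omega>) + N (G n \<omega> - g \<omega>)) \<longlonglongrightarrow> 0"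
      using F(2)[OF \<omega>] G(2)[OF \<omega>] by (rule tendsto_add_zero)
  qed
  ultimately show ?thesis
    unfolding strongly_measurable_def
    by (intro conjI exI[of _ "\<lambda>n \<omega>. F n \<omega> - G n \<omega>"]) (auto simp: mem diff_mem)
qed

text \<open>The norm is continuous along each approximating sequence, so \<open>N (f \<omega>)\<close> is a pointwise limit of
  simple functions.\<close>

lemma measurable_norm:
  assumes "strongly_measurable M Z N f"
  shows "(\<lambda>\<omega>. N (f \<omega>)) \<in> borel_measurable M"
proof -
  obtain F where F: "\<And>n. simple_into M Z (F n)" "\<And>\<omega>. \<omega> \<in> space M \<Longrightarrow> (\<lambda>n. N (F n \<omega> - f \<omega>)) \<longlonglongrightarrow> 0"
    using assms unfolding strongly_measurable_def by blast
  show ?thesis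
  proof (rule borel_measurable_LIMSEQ_real)
    fix n
    have "simple_function M (\<lambda>\<omega>. N (F n \<omega>))"
      using F(1)[of n] by (auto simp: simple_into_def intro: simple_function_compose1)
    then show "(\<lambda>\<omega>. N (F n \<omega>)) \<in> borel_measurable M"
      by (rule borel_measurable_simple_function)
  next
    fix \<omega> assume \<omega>: "\<omega> \<in> space M"
    then show "(\<lambda>n. N (F n \<omega>)) \<longlonglongrightarrow> N (f \<omega>)"
      using F(1) assms by (intro tendsto_norm F(2)) (auto simp: strongly_measurable_def simple_into_def)
  qed
qed

lemma Ls_norm_simple_bounded:
  assumes "prob_space M" and f: "simple_into M Z f" and "1 \<le> s"
  obtains A where "0 < A" "Ls_norm M s N f \<le> ennreal A"
proof -
  interpret prob_space M by fact
  define A where "A = Max (insert 1 ((\<lambda>\<omega>. N (f \<omega>)) ` space M))"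
  have fin: "finite ((\<lambda>\<omega>. N (f \<omega>)) ` space M)"
    using f finite_imageI[of "f ` space M" N] by (simp add: simple_into_def simple_function_def image_image)
  have A: "1 \<le> A" "\<And>\<omega>. \<omega> \<in> space M \<Longrightarrow> N (f \<omega>) \<le> A"
    using fin by (auto simp: A_def)
  have nonneg: "\<And>\<omega>. \<omega> \<in> space M \<Longrightarrow> 0 \<le> N (f \<omega>)"
    using f by (auto simp: simple_into_def intro: norm_nonneg)
  have "Ls_le M s (\<lambda>_. A) A"
    by (simp add: Ls_le_def emeasure_space_1)
  then have "Ls_le M s (\<lambda>\<omega>. N (f \<omega>)) A"
    by (rule Ls_le_mono) (use \<open>1 \<le> s\<close> A nonneg in auto)
  then have "Ls_norm M s N f \<le> ennreal A"
    using A measurable_norm[OF strongly_measurable_simple[OF f]] \<open>1 \<le> s\<close>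
    by (subst Ls_norm_le_iff) auto
  then show ?thesis
    using A by (intro that[of A]) auto
qed

text \<open>Some simple function is at distance less than one, and simple functions have finite norm because
  the measure is finite.\<close>

lemma Ls_norm_bounded:
  assumes "prob_space M" and f: "f \<in> Ls_space M s Z N" and "1 \<le> s"
  obtains A where "0 < A" "Ls_norm M s N f \<le> ennreal A"
proof -
  have sm: "strongly_measurable M Z N f"
    using f by (simp add: Ls_space_iff)
  obtain F where F: "\<And>n. simple_into M Z (F n)" "(\<lambda>n. Ls_norm M s N (F n - f)) \<longlonglongrightarrow> 0"
    using f unfolding Ls_space_iff by blast
  have "eventually (\<lambda>n. Ls_norm M s N (F n - f) < 1) sequentially"
    using F(2) by (rule order_tendstoD) simp
  then obtain n where n: "Ls_norm M s N (F n - f) < ennreal 1"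
    by (auto simp: eventually_sequentially)
  have smF: "strongly_measurable M Z N (F n)"
    by (rule strongly_measurable_simple[OF F(1)])
  obtain A where A: "0 < A" "Ls_norm M s N (F n) \<le> ennreal A"
    using Ls_norm_simple_bounded[OF \<open>prob_space M\<close> F(1) \<open>1 \<le> s\<close>] .
  have mem: "f \<omega> \<in> Z" "F n \<omega> \<in> Z" if "\<omega> \<in> space M" for \<omega>
    using sm smF that by (auto simp: strongly_measurable_def)
  have meas: "(\<lambda>\<omega>. N (F n \<omega>)) \<in> borel_measurable M" "(\<lambda>\<omega>. N ((F n - f) \<omega>)) \<in> borel_measurable M"
    by (intro measurable_norm smF strongly_measurable_diff sm)+
  have "Ls_le M s (\<lambda>\<omega>. N (F n \<omega>)) A" "Ls_le M s (\<lambda>\<omega>. N ((F n - f) \<omega>)) 1"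
    using A n meas \<open>1 \<le> s\<close> by (subst Ls_norm_le_iff[symmetric]; simp)+
  then have "Ls_le M s (\<lambda>\<omega>. N (F n \<omega>) + N ((F n - f) \<omega>)) (A + 1)"
    using A meas \<open>1 \<le> s\<close> mem by (intro Ls_le_add) (auto simp: norm_nonneg diff_mem)
  moreover have "N (f \<omega>) \<le> N (F n \<omega>) + N ((F n - f) \<omega>)" if "\<omega> \<in> space M" for \<omega>
    using norm_diff_le[of "F n \<omega>" "F n \<omega> - f \<omega>"] mem[OF that] by (simp add: diff_mem)
  ultimately have "Ls_le M s (\<lambda>\<omega>. N (f \<omega>)) (A + 1)"
    by (rule Ls_le_mono) (use A \<open>1 \<le> s\<close> mem in \<open>auto simp: norm_nonneg\<close>)
  then have "Ls_norm M s N f \<le> ennreal (A + 1)"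
    using A measurable_norm[OF sm] \<open>1 \<le> s\<close> by (subst Ls_norm_le_iff) auto
  then show ?thesis
    using A by (intro that[of "A + 1"]) auto
qed

end

lemma ennreal_tendsto_0_iff:
  "f \<longlonglongrightarrow> 0 \<longleftrightarrow> (\<forall>\<epsilon>>0. eventually (\<lambda>n. f n < ennreal \<epsilon>) sequentially)"
  for f :: "nat \<Rightarrow> ennreal"
proof
  assume "f \<longlonglongrightarrow> 0"
  then show "\<forall>\<epsilon>>0. eventually (\<lambda>n. f n < ennreal \<epsilon>) sequentially"
    by (auto intro: order_tendstoD)
next
  assume small: "\<forall>\<epsilon>>0. eventually (\<lambda>n. f n < ennreal \<epsilon>) sequentially"
  show "f \<longlonglongrightarrow> 0"
  proof (rule order_tendstoI)
    fix a :: ennreal assume "0 < a"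
    then obtain b where b: "0 < b" "b < a"
      using dense by blast
    then have "b < top"
      using top.not_eq_extremum by fastforce
    then have "b = ennreal (enn2real b)" "0 < enn2real b"
      using b by (simp_all add: enn2real_positive_iff)
    then have "eventually (\<lambda>n. f n < b) sequentially"
      using small by metis
    then show "eventually (\<lambda>n. f n < a) sequentially"
      by eventually_elim (use b in auto)
  qed simp
qed

section \<open>Bounded pairings act on the spaces \<open>L\<^sup>s\<close>\<close>

text \<open>A bounded bilinear map \<open>b\<close> satisfies the estimate below because
  \<open>b x' y' - b x y = b (x' - x) y' + b x (y' - y)\<close>. It measures the continuity of \<open>b\<close>
  and mentions only differences in the carriers, so it can be integrated over \<open>\<Omega>\<close>.\<close>

locale bounded_pairing = X: normed_carrier X NX + Y: normed_carrier Y NY + W: normed_carrier W NW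
  for X :: "'x::ab_group_add set" and NX and Y :: "'y::ab_group_add set" and NY
    and W :: "'u::ab_group_add set" and NW +
  fixes b :: "'x \<Rightarrow> 'y \<Rightarrow> 'u"
  assumes mem: "x \<in> X \<Longrightarrow> y \<in> Y \<Longrightarrow> b x y \<in> W"
    and norm_diff: "x \<in> X \<Longrightarrow> x' \<in> X \<Longrightarrow> y \<in> Y \<Longrightarrow> y' \<in> Y \<Longrightarrow>
      NW (b x' y' - b x y) \<le> NX (x' - x) * NY y' + NX x * NY (y' - y)"
begin

lemma strongly_measurable_pairing:
  assumes "strongly_measurable M X NX f" and "strongly_measurable M Y NY g"
  shows "strongly_measurable M W NW (\<lambda>\<omega>. b (f \<omega>) (g \<omega>))"
proof -
  obtain F where F: "\<And>n. simple_into M X (F n)" "\<And>\<omega>. \<omega> \<in> space M \<Longrightarrow> (\<lambda>n. NX (F n \<omega> - f \<omega>)) \<longlonglongrightarrow> 0"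
    using assms(1) unfolding strongly_measurable_def by blast
  obtain G where G: "\<And>n. simple_into M Y (G n)" "\<And>\<omega>. \<omega> \<in> space M \<Longrightarrow> (\<lambda>n. NY (G n \<omega> - g \<omega>)) \<longlonglongrightarrow> 0"
    using assms(2) unfolding strongly_measurable_def by blast
  have mems: "f \<omega> \<in> X" "g \<omega> \<in> Y" "F n \<omega> \<in> X" "G n \<omega> \<in> Y" if "\<omega> \<in> space M" for \<omega> n
    using assms F(1)[of n] G(1)[of n] that by (auto simp: strongly_measurable_def simple_into_def)
  have "simple_into M W (\<lambda>\<omega>. b (F n \<omega>) (G n \<omega>))" for n
    by (rule simple_into_compose2[OF F(1) G(1)]) (rule mem)
  moreover have "(\<lambda>n. NW (b (F n \<omega>) (G n \<omega>) - b (f \<omega>) (g \<omega>))) \<longlonglongrightarrow> 0" if \<omega>: "\<omega> \<in> space M" for \<omega>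
  proof (rule Lim_null_comparison[OF always_eventually, OF allI])
    fix n
    show "norm (NW (b (F n \<omega>) (G n \<omega>) - b (f \<omega>) (g \<omega>)))
        \<le> NX (F n \<omega> - f \<omega>) * NY (G n \<omega>) + NX (f \<omega>) * NY (G n \<omega> - g \<omega>)"
      using mems[OF \<omega>] by (simp add: norm_diff W.norm_nonneg W.diff_mem mem)
  next
    have "(\<lambda>n. NY (G n \<omega>)) \<longlonglongrightarrow> NY (g \<omega>)"
      using mems[OF \<omega>] by (intro Y.tendsto_norm G(2) \<omega>)
    then show "(\<lambda>n. NX (F n \<omega> - f \<omega>) * NY (G n \<omega>) + NX (f \<omega>) * NY (G n \<omega> - g \<omega>)) \<longlonglongrightarrow> 0"
      using F(2)[OF \<omega>] G(2)[OF \<omega>] by (auto intro!: tendsto_eq_intros)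
  qed
  ultimately show ?thesis
    unfolding strongly_measurable_def
    by (intro conjI exI[of _ "\<lambda>n \<omega>. b (F n \<omega>) (G n \<omega>)"]) (auto simp: mems mem)
qed

text \<open>The pointwise estimate, with \<open>N y' \<le> N (y' - y) + N y\<close>, integrated by means of the inequalities of
  Hoelder and Minkowski.\<close>

lemma Ls_norm_pairing_diff_le:
  assumes rqs: "1 \<le> r" "1 \<le> q" "1 \<le> s" "1 / q + 1 / r = 1 / s"
    and f: "strongly_measurable M X NX f" and f': "strongly_measurable M X NX f'"
    and g: "strongly_measurable M Y NY g" and g': "strongly_measurable M Y NY g'"
    and A: "0 < A" "Ls_norm M r NX f \<le> ennreal A" and B: "0 < B" "Ls_norm M q NY g \<le> ennreal B"
    and \<delta>: "0 < \<delta>" "Ls_norm M r NX (f' - f) \<le> ennreal \<delta>" "Ls_norm M q NY (g' - g) \<le> ennreal \<delta>"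
  shows "Ls_norm M s NW ((\<lambda>\<omega>. b (f' \<omega>) (g' \<omega>)) - (\<lambda>\<omega>. b (f \<omega>) (g \<omega>)))
    \<le> ennreal (\<delta> * (\<delta> + B) + A * \<delta>)"
proof -
  have mems: "f \<omega> \<in> X" "f' \<omega> \<in> X" "g \<omega> \<in> Y" "g' \<omega> \<in> Y" if "\<omega> \<in> space M" for \<omega>
    using f f' g g' that by (auto simp: strongly_measurable_def)
  note nonneg = X.norm_nonneg Y.norm_nonneg X.diff_mem Y.diff_mem mems
  let ?a = "\<lambda>\<omega>. NX (f \<omega>)" and ?b = "\<lambda>\<omega>. NY (g \<omega>)"
    and ?da = "\<lambda>\<omega>. NX ((f' - f) \<omega>)" and ?db = "\<lambda>\<omega>. NY ((g' - g) \<omega>)"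
    and ?D = "(\<lambda>\<omega>. b (f' \<omega>) (g' \<omega>)) - (\<lambda>\<omega>. b (f \<omega>) (g \<omega>))"
  have meas [measurable]: "?a \<in> borel_measurable M" "?b \<in> borel_measurable M"
    "?da \<in> borel_measurable M" "?db \<in> borel_measurable M"
    by (intro X.measurable_norm Y.measurable_norm X.strongly_measurable_diff
        Y.strongly_measurable_diff f f' g g')+
  have a: "Ls_le M r ?a A" and b: "Ls_le M q ?b B" and da: "Ls_le M r ?da \<delta>" and db: "Ls_le M q ?db \<delta>"
    using A B \<delta> rqs meas by (subst Ls_norm_le_iff[symmetric]; simp)+
  have "Ls_le M q (\<lambda>\<omega>. ?db \<omega> + ?b \<omega>) (\<delta> + B)"
    by (intro Ls_le_add meas db b \<delta> B rqs) (simp_all add: nonneg)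
  then have "Ls_le M s (\<lambda>\<omega>. ?da \<omega> * (?db \<omega> + ?b \<omega>)) (\<delta> * (\<delta> + B))"
    using \<delta> B meas by (intro Ls_le_mult[OF _ _ _ _ da _ _ _ rqs] borel_measurable_add) (simp_all add: nonneg)
  moreover have "Ls_le M s (\<lambda>\<omega>. ?a \<omega> * ?db \<omega>) (A * \<delta>)"
    using \<delta> A meas by (intro Ls_le_mult[OF _ _ _ _ a db _ _ rqs]) (simp_all add: nonneg)
  ultimately have "Ls_le M s (\<lambda>\<omega>. ?da \<omega> * (?db \<omega> + ?b \<omega>) + ?a \<omega> * ?db \<omega>) (\<delta> * (\<delta> + B) + A * \<delta>)"
    using \<delta> A B rqs meas
    by (intro Ls_le_add borel_measurable_add borel_measurable_times) (simp_all add: nonneg)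
  moreover have "NW (?D \<omega>) \<le> ?da \<omega> * (?db \<omega> + ?b \<omega>) + ?a \<omega> * ?db \<omega>" if \<omega>: "\<omega> \<in> space M" for \<omega>
  proof -
    have "NW (?D \<omega>) \<le> ?da \<omega> * NY (g' \<omega>) + ?a \<omega> * ?db \<omega>"
      using mems[OF \<omega>] by (simp add: norm_diff)
    also have "?da \<omega> * NY (g' \<omega>) \<le> ?da \<omega> * (?db \<omega> + ?b \<omega>)"
      using mems[OF \<omega>] by (intro mult_left_mono) (simp_all add: Y.norm_le_diff X.norm_nonneg X.diff_mem)
    finally show ?thesis
      by simp
  qed
  ultimately have "Ls_le M s (\<lambda>\<omega>. NW (?D \<omega>)) (\<delta> * (\<delta> + B) + A * \<delta>)"
    by (rule Ls_le_mono) (use \<delta> A B rqs in \<open>simp_all add: W.norm_nonneg W.diff_mem mem mems\<close>)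
  moreover have "(\<lambda>\<omega>. NW (?D \<omega>)) \<in> borel_measurable M"
    by (intro W.measurable_norm W.strongly_measurable_diff strongly_measurable_pairing f f' g g')
  ultimately show ?thesis
    using \<delta> A B rqs by (subst Ls_norm_le_iff) auto
qed

lemma pairing_continuous:
  assumes "prob_space M" and rqs: "1 \<le> r" "1 \<le> q" "1 \<le> s" "1 / q + 1 / r = 1 / s"
    and f: "f \<in> Ls_space M r X NX" and g: "g \<in> Ls_space M q Y NY" and "0 < \<epsilon>"
  shows "\<exists>\<delta>>0. \<forall>f' g'. strongly_measurable M X NX f' \<longrightarrow> strongly_measurable M Y NY g' \<longrightarrow>
      Ls_norm M r NX (f' - f) < ennreal \<delta> \<longrightarrow> Ls_norm M q NY (g' - g) < ennreal \<delta> \<longrightarrow>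
      Ls_norm M s NW ((\<lambda>\<omega>. b (f' \<omega>) (g' \<omega>)) - (\<lambda>\<omega>. b (f \<omega>) (g \<omega>))) < ennreal \<epsilon>"
proof -
  obtain A where A: "0 < A" "Ls_norm M r NX f \<le> ennreal A"
    using X.Ls_norm_bounded[OF \<open>prob_space M\<close> f rqs(1)] .
  obtain B where B: "0 < B" "Ls_norm M q NY g \<le> ennreal B"
    using Y.Ls_norm_bounded[OF \<open>prob_space M\<close> g rqs(2)] .
  \<comment> \<open>The bound of the preceding lemma is at most \<open>\<delta> (1 + B + A)\<close> when \<open>\<delta> \<le> 1\<close>; the factor two
    makes the final inequality strict.\<close>
  define \<delta> where "\<delta> = min 1 (\<epsilon> / (2 * (1 + B + A)))"
  have \<delta>: "0 < \<delta>" "\<delta> \<le> 1" "\<delta> * (1 + B + A) \<le> \<epsilon> / 2"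
  proof -
    have pos: "0 < 2 * (1 + B + A)"
      using A B by simp
    then show "0 < \<delta>" "\<delta> \<le> 1"
      using \<open>0 < \<epsilon>\<close> by (simp_all add: \<delta>_def)
    have "\<delta> \<le> \<epsilon> / (2 * (1 + B + A))"
      by (simp add: \<delta>_def)
    then show "\<delta> * (1 + B + A) \<le> \<epsilon> / 2"
      using pos by (simp add: pos_le_divide_eq algebra_simps)
  qed
  have "\<delta> * (\<delta> + B) + A * \<delta> = \<delta> * (\<delta> + B + A)"
    by (simp add: algebra_simps)
  also have "\<dots> \<le> \<delta> * (1 + B + A)"
    using \<delta> by (intro mult_left_mono) auto
  also have "\<dots> < \<epsilon>"
    using \<delta> \<open>0 < \<epsilon>\<close> by linarith
  finally have less: "ennreal (\<delta> * (\<delta> + B) + A * \<delta>) < ennreal \<epsilon>"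
    using \<open>0 < \<epsilon>\<close> by (simp add: ennreal_lessI)
  show ?thesis
  proof (intro exI[of _ \<delta>] conjI allI impI \<delta>(1))
    fix f' g'
    assume "strongly_measurable M X NX f'" "strongly_measurable M Y NY g'"
      "Ls_norm M r NX (f' - f) < ennreal \<delta>" "Ls_norm M q NY (g' - g) < ennreal \<delta>"
    then have "Ls_norm M s NW ((\<lambda>\<omega>. b (f' \<omega>) (g' \<omega>)) - (\<lambda>\<omega>. b (f \<omega>) (g \<omega>)))
        \<le> ennreal (\<delta> * (\<delta> + B) + A * \<delta>)"
      using f g A B \<delta>(1) by (intro Ls_norm_pairing_diff_le[OF rqs]) (auto simp: Ls_space_iff)
    then show "Ls_norm M s NW ((\<lambda>\<omega>. b (f' \<omega>) (g' \<omega>)) - (\<lambda>\<omega>. b (f \<omega>) (g \<omega>))) < ennreal \<epsilon>"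
      using less by (rule le_less_trans)
  qed
qed

text \<open>Applied to approximating simple functions, \<open>b\<close> gives simple functions. These converge to
  \<open>b (f \<omega>) (g \<omega>)\<close> in norm by the continuity just proved.\<close>

lemma pairing_Ls_space:
  assumes "prob_space M" and rqs: "1 \<le> r" "1 \<le> q" "1 \<le> s" "1 / q + 1 / r = 1 / s"
    and f: "f \<in> Ls_space M r X NX" and g: "g \<in> Ls_space M q Y NY"
  shows "(\<lambda>\<omega>. b (f \<omega>) (g \<omega>)) \<in> Ls_space M s W NW"
proof -
  obtain F where F: "\<And>n. simple_into M X (F n)" "(\<lambda>n. Ls_norm M r NX (F n - f)) \<longlonglongrightarrow> 0"
    using f unfolding Ls_space_iff by blast
  obtain G where G: "\<And>n. simple_into M Y (G n)" "(\<lambda>n. Ls_norm M q NY (G n - g)) \<longlonglongrightarrow> 0"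
    using g unfolding Ls_space_iff by blast
  have "simple_into M W (\<lambda>\<omega>. b (F n \<omega>) (G n \<omega>))" for n
    by (rule simple_into_compose2[OF F(1) G(1)]) (rule mem)
  moreover have "(\<lambda>n. Ls_norm M s NW ((\<lambda>\<omega>. b (F n \<omega>) (G n \<omega>)) - (\<lambda>\<omega>. b (f \<omega>) (g \<omega>)))) \<longlonglongrightarrow> 0"
    unfolding ennreal_tendsto_0_iff
  proof (intro allI impI)
    fix \<epsilon> :: real assume "0 < \<epsilon>"
    obtain \<delta> where \<delta>: "0 < \<delta>"
      "\<And>f' g'. strongly_measurable M X NX f' \<Longrightarrow> strongly_measurable M Y NY g' \<Longrightarrow>
        Ls_norm M r NX (f' - f) < ennreal \<delta> \<Longrightarrow> Ls_norm M q NY (g' - g) < ennreal \<delta> \<Longrightarrow>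
        Ls_norm M s NW ((\<lambda>\<omega>. b (f' \<omega>) (g' \<omega>)) - (\<lambda>\<omega>. b (f \<omega>) (g \<omega>))) < ennreal \<epsilon>"
      using pairing_continuous[OF \<open>prob_space M\<close> rqs f g \<open>0 < \<epsilon>\<close>] by blast
    have "eventually (\<lambda>n. Ls_norm M r NX (F n - f) < ennreal \<delta>) sequentially"
      "eventually (\<lambda>n. Ls_norm M q NY (G n - g) < ennreal \<delta>) sequentially"
      using F(2) G(2) \<delta>(1) unfolding ennreal_tendsto_0_iff by blast+
    then show "eventually (\<lambda>n. Ls_norm M s NW
        ((\<lambda>\<omega>. b (F n \<omega>) (G n \<omega>)) - (\<lambda>\<omega>. b (f \<omega>) (g \<omega>))) < ennreal \<epsilon>) sequentially"
      by eventually_elim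
        (intro \<delta>(2) X.strongly_measurable_simple Y.strongly_measurable_simple F(1) G(1))
  qed
  ultimately show ?thesis
    unfolding Ls_space_iff
    by (intro conjI strongly_measurable_pairing exI[of _ "\<lambda>n \<omega>. b (F n \<omega>) (G n \<omega>)"] allI)
       (use f g in \<open>simp_all add: Ls_space_iff\<close>)
qed

end

section \<open>The integral of a single path\<close>

definition pathwise_integral ::
    "'k set \<Rightarrow> (nat \<Rightarrow> 'k \<Rightarrow> 'k) \<Rightarrow> ('k \<Rightarrow> 'h \<Rightarrow> 'h) \<Rightarrow> ('k \<Rightarrow> 'h::ultranormed_group) \<Rightarrow> 'k \<Rightarrow> 'h" where
  "pathwise_integral T \<sigma> e h =
     (\<lambda>t. if t \<in> T then (\<Sum>j. e (\<sigma> j t) (h (\<sigma> (Suc j) t) - h (\<sigma> j t))) else 0)"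

lemma stochastic_integral_eq_pathwise:
  "stochastic_integral T \<sigma> E w = (\<lambda>\<omega>. pathwise_integral T \<sigma> (E \<omega>) (w \<omega>))"
  by (intro ext) (simp add: stochastic_integral_def pathwise_integral_def integral_term_def[abs_def])

text \<open>All that convergence, continuity and size of the integral of a path depend on: the operators
  \<open>e t\<close> have a common bound.\<close>

definition bounded_path :: "'k set \<Rightarrow> real \<Rightarrow> ('k \<Rightarrow> 'h::ultranormed_group \<Rightarrow> 'h) \<Rightarrow> bool" where
  "bounded_path T a e \<longleftrightarrow> 0 \<le> a \<and> (\<forall>t\<in>T. \<forall>x. unorm (e t x) \<le> a * unorm x)"

lemma C0_continuous_on:
  fixes h :: "'k::metric_space \<Rightarrow> 'h::ultranormed_group"
  assumes "h \<in> C0 T UNIV unorm"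
  shows "continuous_on T h"
  unfolding continuous_on_def
proof
  fix t assume "t \<in> T"
  then show "(h \<longlongrightarrow> h t) (at t within T)"
    using assms by (subst tendsto_unorm_iff) (simp add: C0_def)
qed

locale path_integration =
  fixes T :: "'k::ultranormed_group set" and t0 and \<sigma> :: "nat \<Rightarrow> 'k \<Rightarrow> 'k"
  assumes T: "compact T" and approx: "approximation_of_identity T t0 \<sigma>"
begin

lemma \<sigma>_mem: "t \<in> T \<Longrightarrow> \<sigma> n t \<in> T"
  using approx by (simp add: approximation_of_identity_def)

lemma \<sigma>_0: "t \<in> T \<Longrightarrow> \<sigma> 0 t = t0"
  using approx by (simp add: approximation_of_identity_def)

lemma mesh:
  obtains \<rho> :: real where "0 < \<rho>" "\<rho> < 1"
    "\<And>n x y. 1 \<le> n \<Longrightarrow> x \<in> T \<Longrightarrow> y \<in> T \<Longrightarrow> unorm (x - y) < \<rho> ^ n \<Longrightarrow> \<sigma> n x = \<sigma> n y"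
    "\<And>n x. 1 \<le> n \<Longrightarrow> x \<in> T \<Longrightarrow> unorm (\<sigma> n x - x) < \<rho> ^ n"
  using approx unfolding approximation_of_identity_def by metis

text \<open>Consecutive points \<open>\<sigma>\<^sub>j t\<close> and \<open>\<sigma>\<^bsub>j+1\<^esub> t\<close> are closer than \<open>\<rho>\<^sup>j\<close> for \<open>j \<ge> 1\<close>, and \<open>h\<close> is
  uniformly continuous on the compact set \<open>T\<close>.\<close>

lemma increments_uniformly_small:
  fixes h :: "'k \<Rightarrow> 'h::ultranormed_group"
  assumes h: "h \<in> C0 T UNIV unorm" and "0 < \<epsilon>"
  obtains J where "\<And>j t. J \<le> j \<Longrightarrow> t \<in> T \<Longrightarrow> unorm (h (\<sigma> (Suc j) t) - h (\<sigma> j t)) < \<epsilon>"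
proof -
  obtain \<rho> :: real where \<rho>: "0 < \<rho>" "\<rho> < 1"
    and close: "\<And>n x. 1 \<le> n \<Longrightarrow> x \<in> T \<Longrightarrow> unorm (\<sigma> n x - x) < \<rho> ^ n"
    using mesh by metis
  have "uniformly_continuous_on T h"
    by (intro compact_uniformly_continuous C0_continuous_on h T)
  then obtain d where d: "0 < d" "\<And>x y. x \<in> T \<Longrightarrow> y \<in> T \<Longrightarrow> dist y x < d \<Longrightarrow> dist (h y) (h x) < \<epsilon>"
    using \<open>0 < \<epsilon>\<close> unfolding uniformly_continuous_on_def by metis
  obtain J where J: "\<rho> ^ J < d"
    using real_arch_pow_inv[OF d(1) \<rho>(2)] by blast
  show ?thesis
  proof (rule that)
    \<comment> \<open>The successor ensures \<open>j \<ge> 1\<close>, where the estimates of the mesh begin.\<close>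
    fix j t assume j: "Suc J \<le> j" and t: "t \<in> T"
    have "unorm (\<sigma> (Suc j) t - t) \<le> \<rho> ^ j"
      using close[of "Suc j" t] t \<rho> power_decreasing[of j "Suc j" \<rho>] by linarith
    moreover have "unorm (\<sigma> j t - t) \<le> \<rho> ^ j"
      using close[of j t] t j by simp
    ultimately have "unorm ((\<sigma> (Suc j) t - t) - (\<sigma> j t - t)) \<le> \<rho> ^ j"
      by (rule unorm_diff_le)
    moreover have "\<rho> ^ j \<le> \<rho> ^ J"
      using \<rho> j by (intro power_decreasing) auto
    ultimately have "dist (\<sigma> (Suc j) t) (\<sigma> j t) < d"
      using J by (simp add: dist_unorm)
    then show "unorm (h (\<sigma> (Suc j) t) - h (\<sigma> j t)) < \<epsilon>"
      using d(2) \<sigma>_mem t by (simp flip: dist_unorm)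
  qed
qed

text \<open>The bound \<open>a\<close> may be zero, hence the division by \<open>a + 1\<close>.\<close>

lemma terms_uniformly_small:
  fixes h :: "'k \<Rightarrow> 'h::ultranormed_group"
  assumes e: "bounded_path T a e" and h: "h \<in> C0 T UNIV unorm" and "0 < \<epsilon>"
  obtains J where "\<And>j t. J \<le> j \<Longrightarrow> t \<in> T \<Longrightarrow> unorm (e (\<sigma> j t) (h (\<sigma> (Suc j) t) - h (\<sigma> j t))) < \<epsilon>"
proof -
  have a: "0 < a + 1"
    using e by (simp add: bounded_path_def)
  then obtain J where J: "\<And>j t. J \<le> j \<Longrightarrow> t \<in> T \<Longrightarrow> unorm (h (\<sigma> (Suc j) t) - h (\<sigma> j t)) < \<epsilon> / (a + 1)"
    using increments_uniformly_small[OF h, of "\<epsilon> / (a + 1)"] \<open>0 < \<epsilon>\<close> by auto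
  show ?thesis
  proof (rule that)
    fix j t assume j: "J \<le> j" and t: "t \<in> T"
    let ?d = "h (\<sigma> (Suc j) t) - h (\<sigma> j t)"
    have "unorm (e (\<sigma> j t) ?d) \<le> a * unorm ?d"
      using e \<sigma>_mem[OF t] by (simp add: bounded_path_def)
    also have "\<dots> \<le> (a + 1) * unorm ?d"
      by (simp add: mult_right_mono)
    also have "\<dots> < \<epsilon>"
      using J[OF j t] a by (simp add: pos_less_divide_eq mult.commute)
    finally show "unorm (e (\<sigma> j t) ?d) < \<epsilon>" .
  qed
qed

lemma pathwise_summable:
  fixes h :: "'k \<Rightarrow> 'h::{ultranormed_group, complete_space}"
  assumes e: "bounded_path T a e" and h: "h \<in> C0 T UNIV unorm" and t: "t \<in> T"
  shows "summable (\<lambda>j. e (\<sigma> j t) (h (\<sigma> (Suc j) t) - h (\<sigma> j t)))"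
proof (rule summable_if_terms_vanish, rule LIMSEQ_I)
  fix \<epsilon> :: real assume "0 < \<epsilon>"
  then obtain J where "\<And>j t. J \<le> j \<Longrightarrow> t \<in> T \<Longrightarrow> unorm (e (\<sigma> j t) (h (\<sigma> (Suc j) t) - h (\<sigma> j t))) < \<epsilon>"
    using terms_uniformly_small[OF e h] by metis
  then show "\<exists>J. \<forall>j\<ge>J. norm (unorm (e (\<sigma> j t) (h (\<sigma> (Suc j) t) - h (\<sigma> j t))) - 0) < \<epsilon>"
    using t by auto
qed

lemma pathwise_sums:
  fixes h :: "'k \<Rightarrow> 'h::{ultranormed_group, complete_space}"
  assumes "bounded_path T a e" and "h \<in> C0 T UNIV unorm" and "t \<in> T"
  shows "(\<lambda>j. e (\<sigma> j t) (h (\<sigma> (Suc j) t) - h (\<sigma> j t))) sums pathwise_integral T \<sigma> e h t"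
  using summable_sums[OF pathwise_summable[OF assms]] assms(3) by (simp add: pathwise_integral_def)

text \<open>Locally in \<open>t\<close> only the tail of the series varies, and the tail is uniformly small.\<close>

lemma pathwise_integral_C0:
  fixes h :: "'k \<Rightarrow> 'h::{ultranormed_group, complete_space}"
  assumes e: "bounded_path T a e" and h: "h \<in> C0 T UNIV unorm"
  shows "pathwise_integral T \<sigma> e h \<in> C0 T UNIV unorm"
proof -
  let ?P = "pathwise_integral T \<sigma> e h"
  let ?f = "\<lambda>t j. e (\<sigma> j t) (h (\<sigma> (Suc j) t) - h (\<sigma> j t))"
  have "((\<lambda>u. unorm (?P u - ?P t)) \<longlongrightarrow> 0) (at t within T)" if t: "t \<in> T" for t
  proof (rule tendstoI)
    fix \<epsilon> :: real assume \<epsilon>: "0 < \<epsilon>"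
    then obtain J where J: "\<And>j t. J \<le> j \<Longrightarrow> t \<in> T \<Longrightarrow> unorm (?f t j) < \<epsilon> / 2"
      using terms_uniformly_small[OF e h, of "\<epsilon> / 2"] by auto
    obtain \<rho> :: real where \<rho>: "0 < \<rho>" "\<rho> < 1"
      and const: "\<And>n x y. 1 \<le> n \<Longrightarrow> x \<in> T \<Longrightarrow> y \<in> T \<Longrightarrow> unorm (x - y) < \<rho> ^ n \<Longrightarrow> \<sigma> n x = \<sigma> n y"
      using mesh by metis
    have small: "unorm (?P u - ?P t) < \<epsilon>" if u: "u \<in> T" and ut: "dist u t < \<rho> ^ J" for u
    proof -
      have same: "\<sigma> j u = \<sigma> j t" if "j \<le> J" for j
      proof (cases "j = 0")
        case True
        then show ?thesis
          using u t \<sigma>_0 by simp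
      next
        case False
        have "\<rho> ^ J \<le> \<rho> ^ j"
          using \<rho> that by (intro power_decreasing) auto
        then show ?thesis
          using False u t ut by (intro const) (auto simp: dist_unorm)
      qed
      have "unorm (?f u j - ?f t j) \<le> \<epsilon> / 2" for j
      proof (cases "J \<le> j")
        case True
        then show ?thesis
          using J[OF True u] J[OF True t] by (intro unorm_diff_le) auto
      next
        case False
        then have "?f u j = ?f t j"
          using same[of j] same[of "Suc j"] by simp
        then show ?thesis
          using \<epsilon> by simp
      qed
      then have "unorm (?P u - ?P t) \<le> \<epsilon> / 2"
        by (rule unorm_sums_le[OF sums_group_diff[OF pathwise_sums[OF e h u] pathwise_sums[OF e h t]]])
      then show ?thesis
        using \<epsilon> by linarith
    qed
    show "\<forall>\<^sub>F u in at t within T. dist (unorm (?P u - ?P t)) 0 < \<epsilon>"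
      unfolding eventually_at using small \<rho> by (intro exI[of _ "\<rho> ^ J"]) auto
  qed
  then show ?thesis
    by (simp add: C0_def pathwise_integral_def)
qed

text \<open>Each term is at most \<open>a \<parallel>h\<parallel>\<close>, and by the strong triangle inequality so is the whole sum.\<close>

lemma pathwise_integral_le:
  fixes h :: "'k \<Rightarrow> 'h::{ultranormed_group, complete_space}"
  assumes e: "bounded_path T a e" and h: "h \<in> C0 T UNIV unorm" and t: "t \<in> T"
  shows "unorm (pathwise_integral T \<sigma> e h t) \<le> a * sup_norm T unorm h"
proof (rule unorm_sums_le[OF pathwise_sums[OF e h t]])
  fix j
  let ?d = "h (\<sigma> (Suc j) t) - h (\<sigma> j t)"
  have "unorm (e (\<sigma> j t) ?d) \<le> a * unorm ?d"
    using e \<sigma>_mem[OF t] by (simp add: bounded_path_def)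
  also have "\<dots> \<le> a * sup_norm T unorm h"
    using e \<sigma>_mem[OF t] normed_carrier.norm_le_sup_norm[OF normed_carrier_unorm T h]
    by (intro mult_left_mono unorm_diff_le) (auto simp: bounded_path_def)
  finally show "unorm (e (\<sigma> j t) ?d) \<le> a * sup_norm T unorm h" .
qed

end

section \<open>The stochastic integral as a bounded pairing\<close>

lemma fun_scale_apply: "fun_scale sc c f i = sc c (f i)"
  by (simp add: fun_scale_def)

lemma Ls_space_mono:
  assumes "X \<subseteq> Y"
  shows "Ls_space M s X N \<subseteq> Ls_space M s Y N"
proof -
  have "simple_into M X f \<Longrightarrow> simple_into M Y f" for f
    using assms by (auto simp: simple_into_def)
  then show ?thesis
    using assms unfolding Ls_space_def by blast
qed

lemma (in nonarch_banach_space) sums_smul: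
  assumes "f sums a"
  shows "(\<lambda>n. smul c (f n)) sums smul c a"
proof -
  have "(\<lambda>n. unorm c * unorm ((\<Sum>i<n. f i) - a)) \<longlonglongrightarrow> 0"
    using assms unfolding sums_def
    by (intro tendsto_mult_right_zero) (simp add: tendsto_unorm_iff[of "\<lambda>n. \<Sum>i<n. f i"])
  moreover have "unorm c * unorm ((\<Sum>i<n. f i) - a) = unorm ((\<Sum>i<n. smul c (f i)) - smul c a)" for n
    by (simp add: unorm_smul flip: scale_sum_right scale_right_diff_distrib)
  ultimately have "(\<lambda>n. unorm ((\<Sum>i<n. smul c (f i)) - smul c a)) \<longlonglongrightarrow> 0"
    by simp
  then show ?thesis
    unfolding sums_def by (subst tendsto_unorm_iff)
qed

locale Lv_path_integration = path_integration T t0 \<sigma> + nonarch_banach_space smul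
  for T :: "'k::nonarch_field set" and t0 \<sigma>
    and smul :: "'k \<Rightarrow> 'h::{ultranormed_group, complete_space} \<Rightarrow> 'h" +
  fixes v :: ennreal
  assumes v: "1 \<le> v" and t0: "t0 \<in> T"
begin

abbreviation LvC0 :: "('k \<Rightarrow> 'h \<Rightarrow> 'h) set" where
  "LvC0 \<equiv> C0 T (Lv_space smul v) (Lv_norm smul v)"

abbreviation LvC0_norm :: "('k \<Rightarrow> 'h \<Rightarrow> 'h) \<Rightarrow> real" where
  "LvC0_norm \<equiv> sup_norm T (Lv_norm smul v)"

sublocale Lv: normed_carrier "Lv_space smul v" "Lv_norm smul v"
  by (rule normed_carrier_Lv[OF nonarch_banach_space_axioms v])

sublocale LvC0: normed_carrier LvC0 LvC0_norm
  by (rule Lv.normed_carrier_C0[OF T]) (use t0 in auto)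

sublocale HC0: normed_carrier "C0 T UNIV unorm :: ('k \<Rightarrow> 'h) set" "sup_norm T unorm"
  by (rule normed_carrier.normed_carrier_C0[OF normed_carrier_unorm T]) (use t0 in auto)

lemma bounded_path_Lv:
  assumes e: "e \<in> LvC0"
  shows "bounded_path T (LvC0_norm e) e"
  unfolding bounded_path_def
proof (intro conjI ballI allI)
  show "0 \<le> LvC0_norm e"
    by (rule LvC0.norm_nonneg[OF e])
  fix t x assume t: "t \<in> T"
  have Lv: "e t \<in> Lv_space smul v"
    by (rule Lv.C0_mem[OF e t])
  then have "unorm (e t x) \<le> operator_norm (e t) * unorm x"
    by (intro unorm_le_operator_norm[of smul smul]) (simp add: Lv_space_def)
  also have "operator_norm (e t) \<le> Lv_norm smul v (e t)"
    by (rule operator_norm_le_Lv_norm[OF nonarch_banach_space_axioms v Lv])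
  also have "\<dots> \<le> LvC0_norm e"
    by (rule Lv.norm_le_sup_norm[OF T e t])
  finally show "unorm (e t x) \<le> LvC0_norm e * unorm x"
    by (simp add: mult_right_mono)
qed

lemma Lv_linear:
  assumes "e \<in> LvC0" and "t \<in> T"
  shows "e t (x + y) = e t x + e t y" and "e t (x - y) = e t x - e t y"
    and "e t (smul c x) = smul c (e t x)"
proof -
  have lin: "Vector_Spaces.linear smul smul (e t)"
    using Lv.C0_mem[OF assms] by (simp add: Lv_space_def bounded_operator_def)
  then show add: "e t (x + y) = e t x + e t y" for x y
    by (simp add: Vector_Spaces.linear_iff)
  show "e t (x - y) = e t x - e t y"
    using add[of "x - y" y] by simp
  show "e t (smul c x) = smul c (e t x)"
    using lin by (simp add: Vector_Spaces.linear_iff)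
qed

lemmas Lv_sums = pathwise_sums[OF bounded_path_Lv]

text \<open>Linearity of the operators \<open>e t\<close> makes both sides sums of the same series.\<close>

lemma pathwise_integral_diff:
  assumes e: "e \<in> LvC0" "e' \<in> LvC0" and h: "h \<in> C0 T UNIV unorm" "h' \<in> C0 T UNIV unorm" and t: "t \<in> T"
  shows "pathwise_integral T \<sigma> e' h' t - pathwise_integral T \<sigma> e h t =
    pathwise_integral T \<sigma> (e' - e) h' t + pathwise_integral T \<sigma> e (h' - h) t"
proof (rule sums_unique2)
  show "(\<lambda>j. e' (\<sigma> j t) (h' (\<sigma> (Suc j) t) - h' (\<sigma> j t)) - e (\<sigma> j t) (h (\<sigma> (Suc j) t) - h (\<sigma> j t)))
    sums (pathwise_integral T \<sigma> e' h' t - pathwise_integral T \<sigma> e h t)"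
    by (intro sums_group_diff Lv_sums e h t)
  have "(\<lambda>j. (e' - e) (\<sigma> j t) (h' (\<sigma> (Suc j) t) - h' (\<sigma> j t))
      + e (\<sigma> j t) ((h' - h) (\<sigma> (Suc j) t) - (h' - h) (\<sigma> j t)))
    sums (pathwise_integral T \<sigma> (e' - e) h' t + pathwise_integral T \<sigma> e (h' - h) t)"
    by (intro sums_add Lv_sums LvC0.diff_mem HC0.diff_mem e h t)
  moreover have "(e' - e) (\<sigma> j t) (h' (\<sigma> (Suc j) t) - h' (\<sigma> j t))
      + e (\<sigma> j t) ((h' - h) (\<sigma> (Suc j) t) - (h' - h) (\<sigma> j t))
    = e' (\<sigma> j t) (h' (\<sigma> (Suc j) t) - h' (\<sigma> j t)) - e (\<sigma> j t) (h (\<sigma> (Suc j) t) - h (\<sigma> j t))" for j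
  proof -
    have "(h' - h) (\<sigma> (Suc j) t) - (h' - h) (\<sigma> j t)
        = (h' (\<sigma> (Suc j) t) - h' (\<sigma> j t)) - (h (\<sigma> (Suc j) t) - h (\<sigma> j t))"
      by simp
    then have "e (\<sigma> j t) ((h' - h) (\<sigma> (Suc j) t) - (h' - h) (\<sigma> j t))
        = e (\<sigma> j t) (h' (\<sigma> (Suc j) t) - h' (\<sigma> j t)) - e (\<sigma> j t) (h (\<sigma> (Suc j) t) - h (\<sigma> j t))"
      by (simp only: Lv_linear(2)[OF e(1) \<sigma>_mem[OF t]])
    then show ?thesis
      by simp
  qed
  ultimately show "(\<lambda>j. e' (\<sigma> j t) (h' (\<sigma> (Suc j) t) - h' (\<sigma> j t)) - e (\<sigma> j t) (h (\<sigma> (Suc j) t) - h (\<sigma> j t)))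
    sums (pathwise_integral T \<sigma> (e' - e) h' t + pathwise_integral T \<sigma> e (h' - h) t)"
    by (simp only:)
qed

text \<open>The size estimate for the integral of a path, applied to the two summands of
  \<open>pathwise_integral_diff\<close>, is the estimate required of a bounded pairing.\<close>

sublocale pairing: bounded_pairing LvC0 LvC0_norm "C0 T UNIV unorm :: ('k \<Rightarrow> 'h) set" "sup_norm T unorm"
  "C0 T UNIV unorm :: ('k \<Rightarrow> 'h) set" "sup_norm T unorm" "pathwise_integral T \<sigma>"
proof
  fix e and h h' :: "'k \<Rightarrow> 'h"
  assume e: "e \<in> LvC0" and h: "h \<in> C0 T UNIV unorm"
  show "pathwise_integral T \<sigma> e h \<in> C0 T UNIV unorm"
    by (rule pathwise_integral_C0[OF bounded_path_Lv[OF e] h])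
  fix e'
  assume e': "e' \<in> LvC0" and h': "h' \<in> C0 T UNIV unorm"
  show "sup_norm T unorm (pathwise_integral T \<sigma> e' h' - pathwise_integral T \<sigma> e h)
    \<le> LvC0_norm (e' - e) * sup_norm T unorm h' + LvC0_norm e * sup_norm T unorm (h' - h)"
    unfolding sup_norm_def[of T unorm "pathwise_integral T \<sigma> e' h' - pathwise_integral T \<sigma> e h"]
  proof (rule cSUP_least)
    fix t assume t: "t \<in> T"
    have "unorm (pathwise_integral T \<sigma> (e' - e) h' t + pathwise_integral T \<sigma> e (h' - h) t)
      \<le> unorm (pathwise_integral T \<sigma> (e' - e) h' t) + unorm (pathwise_integral T \<sigma> e (h' - h) t)"
      by (intro unorm_add_le) auto
    also have "\<dots> \<le> LvC0_norm (e' - e) * sup_norm T unorm h' + LvC0_norm e * sup_norm T unorm (h' - h)"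
      by (intro add_mono pathwise_integral_le bounded_path_Lv LvC0.diff_mem HC0.diff_mem e e' h h' t)
    finally show "unorm ((pathwise_integral T \<sigma> e' h' - pathwise_integral T \<sigma> e h) t)
      \<le> LvC0_norm (e' - e) * sup_norm T unorm h' + LvC0_norm e * sup_norm T unorm (h' - h)"
      by (simp add: pathwise_integral_diff[OF e e' h h' t])
  qed (use t0 in auto)
qed

lemma pathwise_integral_add_left:
  assumes e: "e \<in> LvC0" "e' \<in> LvC0" and h: "h \<in> C0 T UNIV unorm"
  shows "pathwise_integral T \<sigma> (e + e') h = pathwise_integral T \<sigma> e h + pathwise_integral T \<sigma> e' h"
proof
  fix t
  show "pathwise_integral T \<sigma> (e + e') h t = (pathwise_integral T \<sigma> e h + pathwise_integral T \<sigma> e' h) t"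
  proof (cases "t \<in> T")
    case True
    then show ?thesis
      using sums_unique[OF sums_add[OF Lv_sums[OF e(1) h True] Lv_sums[OF e(2) h True]]]
      by (simp add: pathwise_integral_def[of T \<sigma> "e + e'"])
  qed (simp add: pathwise_integral_def)
qed

lemma pathwise_integral_add_right:
  assumes e: "e \<in> LvC0" and h: "h \<in> C0 T UNIV unorm" "h' \<in> C0 T UNIV unorm"
  shows "pathwise_integral T \<sigma> e (h + h') = pathwise_integral T \<sigma> e h + pathwise_integral T \<sigma> e h'"
proof
  fix t
  show "pathwise_integral T \<sigma> e (h + h') t = (pathwise_integral T \<sigma> e h + pathwise_integral T \<sigma> e h') t"
  proof (cases "t \<in> T")
    case True
    have "e (\<sigma> j t) ((h + h') (\<sigma> (Suc j) t) - (h + h') (\<sigma> j t))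
        = e (\<sigma> j t) (h (\<sigma> (Suc j) t) - h (\<sigma> j t)) + e (\<sigma> j t) (h' (\<sigma> (Suc j) t) - h' (\<sigma> j t))" for j
      by (simp add: add_diff_add flip: Lv_linear(1)[OF e \<sigma>_mem[OF True]])
    then show ?thesis
      using True sums_unique[OF sums_add[OF Lv_sums[OF e h(1) True] Lv_sums[OF e h(2) True]]]
      by (simp add: pathwise_integral_def[of T \<sigma> e "h + h'"])
  qed (simp add: pathwise_integral_def)
qed

lemma pathwise_integral_scale_left:
  assumes e: "e \<in> LvC0" and h: "h \<in> C0 T UNIV unorm"
  shows "pathwise_integral T \<sigma> (fun_scale (fun_scale smul) c e) h = fun_scale smul c (pathwise_integral T \<sigma> e h)"
proof
  fix t
  show "pathwise_integral T \<sigma> (fun_scale (fun_scale smul) c e) h t = fun_scale smul c (pathwise_integral T \<sigma> e h) t"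
  proof (cases "t \<in> T")
    case True
    then show ?thesis
      using sums_unique[OF sums_smul[OF Lv_sums[OF e h True], of c]]
      by (simp add: fun_scale_def pathwise_integral_def[of T \<sigma> "\<lambda>i j. smul c (e i j)"])
  qed (simp add: pathwise_integral_def fun_scale_def)
qed

lemma pathwise_integral_scale_right:
  assumes e: "e \<in> LvC0" and h: "h \<in> C0 T UNIV unorm"
  shows "pathwise_integral T \<sigma> e (fun_scale smul c h) = fun_scale smul c (pathwise_integral T \<sigma> e h)"
proof
  fix t
  show "pathwise_integral T \<sigma> e (fun_scale smul c h) t = fun_scale smul c (pathwise_integral T \<sigma> e h) t"
  proof (cases "t \<in> T")
    case True
    have "e (\<sigma> j t) (smul c (h (\<sigma> (Suc j) t)) - smul c (h (\<sigma> j t)))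
        = smul c (e (\<sigma> j t) (h (\<sigma> (Suc j) t) - h (\<sigma> j t)))" for j
      by (simp flip: scale_right_diff_distrib Lv_linear(3)[OF e \<sigma>_mem[OF True]])
    then show ?thesis
      using True sums_unique[OF sums_smul[OF Lv_sums[OF e h True], of c]]
      by (simp add: fun_scale_def pathwise_integral_def[of T \<sigma> e "\<lambda>i. smul c (h i)"])
  qed (simp add: pathwise_integral_def fun_scale_def)
qed

end

section \<open>Continuity of the stochastic integral\<close>

theorem proposition4p5:
  fixes p :: nat
    and t0 :: "'k::nonarch_field" and R :: real and T :: "'k set"
    and smul :: "'k \<Rightarrow> 'h::{ultranormed_group, complete_space} \<Rightarrow> 'h"
    and M :: "'w measure"
    and \<sigma> :: "nat \<Rightarrow> 'k \<Rightarrow> 'k"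
    and r q s v :: ennreal
    and LE :: "('w \<Rightarrow> 'k \<Rightarrow> 'h \<Rightarrow> 'h) set" and Lw LP :: "('w \<Rightarrow> 'k \<Rightarrow> 'h) set"
  assumes "local_field_over_Qp p TYPE('k)"
    and "0 < R" and T: "T = cball t0 R"
    and "nonarch_banach_space smul"
    and "prob_space M"
    and "approximation_of_identity T t0 \<sigma>"
    and "1 \<le> r" and "1 \<le> q" and "1 \<le> s" and "1 / q + 1 / r = 1 / s"
    and "1 \<le> v"
    and LE: "LE = Ls_space M r (C0 T (Lv_space smul v) (Lv_norm smul v)) (sup_norm T (Lv_norm smul v))"
    and Lw: "Lw = Ls_space M q (C00 T t0 UNIV unorm) (sup_norm T unorm)"
    and LP: "LP = Ls_space M s (C0 T UNIV unorm) (sup_norm T unorm)"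
  shows "(\<forall>E\<in>LE. \<forall>w\<in>Lw. \<forall>\<omega>\<in>space M. \<forall>t\<in>T. summable (integral_term \<sigma> E w \<omega> t)) \<and>
    continuous_bilinear_AE M
      (fun_scale (fun_scale (fun_scale smul))) LE (Ls_norm M r (sup_norm T (Lv_norm smul v)))
      (fun_scale (fun_scale smul)) Lw (Ls_norm M q (sup_norm T unorm))
      (fun_scale (fun_scale smul)) LP (Ls_norm M s (sup_norm T unorm))
      (stochastic_integral T \<sigma>)"
proof -
  have "compact T" "t0 \<in> T"
    using compact_cball_local_field[OF assms(1)] \<open>0 < R\<close> by (auto simp: T)
  then interpret Lv_path_integration T t0 \<sigma> smul v
    using assms by (simp add: Lv_path_integration_def path_integration_def Lv_path_integration_axioms_def)
  note rqs = \<open>1 \<le> r\<close> \<open>1 \<le> q\<close> \<open>1 \<le> s\<close> \<open>1 / q + 1 / r = 1 / s\<close>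
  have Lw_C0: "w \<in> Ls_space M q (C0 T UNIV unorm) (sup_norm T unorm)" if "w \<in> Lw" for w
    using that Ls_space_mono[of "C00 T t0 UNIV unorm" "C0 T UNIV unorm" M q "sup_norm T unorm"]
    by (auto simp: Lw C00_def)
  have E_mem: "E \<omega> \<in> LvC0" if "E \<in> LE" "\<omega> \<in> space M" for E \<omega>
    using that by (simp add: LE Ls_space_def)
  have w_mem: "w \<omega> \<in> C0 T UNIV unorm" if "w \<in> Lw" "\<omega> \<in> space M" for w \<omega>
    using Lw_C0[OF that(1)] that(2) by (simp add: Ls_space_def)
  have "summable (integral_term \<sigma> E w \<omega> t)" if "E \<in> LE" "w \<in> Lw" "\<omega> \<in> space M" "t \<in> T" for E w \<omega> t
    using pathwise_summable[OF bounded_path_Lv[OF E_mem[OF that(1,3)]] w_mem[OF that(2,3)] that(4)]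
    by (simp add: integral_term_def[abs_def])
  moreover have "continuous_bilinear_AE M
      (fun_scale (fun_scale (fun_scale smul))) LE (Ls_norm M r (sup_norm T (Lv_norm smul v)))
      (fun_scale (fun_scale smul)) Lw (Ls_norm M q (sup_norm T unorm))
      (fun_scale (fun_scale smul)) LP (Ls_norm M s (sup_norm T unorm))
      (stochastic_integral T \<sigma>)"
    unfolding continuous_bilinear_AE_def stochastic_integral_eq_pathwise
  proof (intro conjI ballI allI impI)
    fix f g assume f: "f \<in> LE" and g: "g \<in> Lw"
    show "(\<lambda>\<omega>. pathwise_integral T \<sigma> (f \<omega>) (g \<omega>)) \<in> LP"
      unfolding LP using f by (intro pairing.pairing_Ls_space[OF \<open>prob_space M\<close> rqs] Lw_C0 g) (simp add: LE)
    show "AE \<omega> in M. pathwise_integral T \<sigma> (f' \<omega>) (g' \<omega>) = pathwise_integral T \<sigma> (f \<omega>) (g \<omega>)"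
      if "AE \<omega> in M. f' \<omega> = f \<omega>" "AE \<omega> in M. g' \<omega> = g \<omega>" for f' g'
      using that by eventually_elim simp
    show "AE \<omega> in M. pathwise_integral T \<sigma> ((f + f') \<omega>) (g \<omega>) =
        ((\<lambda>\<omega>. pathwise_integral T \<sigma> (f \<omega>) (g \<omega>)) + (\<lambda>\<omega>. pathwise_integral T \<sigma> (f' \<omega>) (g \<omega>))) \<omega>"
      if "f' \<in> LE" for f'
      using f g that by (intro AE_I2) (simp add: pathwise_integral_add_left E_mem w_mem)
    show "AE \<omega> in M. pathwise_integral T \<sigma> (f \<omega>) ((g + g') \<omega>) =
        ((\<lambda>\<omega>. pathwise_integral T \<sigma> (f \<omega>) (g \<omega>)) + (\<lambda>\<omega>. pathwise_integral T \<sigma> (f \<omega>) (g' \<omega>))) \<omega>"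
      if "g' \<in> Lw" for g'
      using f g that by (intro AE_I2) (simp add: pathwise_integral_add_right E_mem w_mem)
    show "AE \<omega> in M. pathwise_integral T \<sigma> (fun_scale (fun_scale (fun_scale smul)) c f \<omega>) (g \<omega>) =
        fun_scale (fun_scale smul) c (\<lambda>\<omega>. pathwise_integral T \<sigma> (f \<omega>) (g \<omega>)) \<omega>" for c
      using f g by (intro AE_I2) (simp add: fun_scale_apply pathwise_integral_scale_left E_mem w_mem)
    show "AE \<omega> in M. pathwise_integral T \<sigma> (f \<omega>) (fun_scale (fun_scale smul) c g \<omega>) =
        fun_scale (fun_scale smul) c (\<lambda>\<omega>. pathwise_integral T \<sigma> (f \<omega>) (g \<omega>)) \<omega>" for c
      using f g by (intro AE_I2) (simp add: fun_scale_apply pathwise_integral_scale_right E_mem w_mem)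
    fix \<epsilon> :: real assume "0 < \<epsilon>"
    then obtain \<delta> where "0 < \<delta>" and \<delta>: "\<And>f' g'. strongly_measurable M LvC0 LvC0_norm f' \<Longrightarrow>
        strongly_measurable M (C0 T UNIV unorm) (sup_norm T unorm) g' \<Longrightarrow>
        Ls_norm M r LvC0_norm (f' - f) < ennreal \<delta> \<Longrightarrow> Ls_norm M q (sup_norm T unorm) (g' - g) < ennreal \<delta> \<Longrightarrow>
        Ls_norm M s (sup_norm T unorm) ((\<lambda>\<omega>. pathwise_integral T \<sigma> (f' \<omega>) (g' \<omega>))
          - (\<lambda>\<omega>. pathwise_integral T \<sigma> (f \<omega>) (g \<omega>))) < ennreal \<epsilon>"
      using pairing.pairing_continuous[OF \<open>prob_space M\<close> rqs f[unfolded LE] Lw_C0[OF g]] by blast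
    show "\<exists>\<delta>>0. \<forall>f'\<in>LE. \<forall>g'\<in>Lw.
        max (Ls_norm M r LvC0_norm (f' - f)) (Ls_norm M q (sup_norm T unorm) (g' - g)) < ennreal \<delta> \<longrightarrow>
        Ls_norm M s (sup_norm T unorm) ((\<lambda>\<omega>. pathwise_integral T \<sigma> (f' \<omega>) (g' \<omega>))
          - (\<lambda>\<omega>. pathwise_integral T \<sigma> (f \<omega>) (g \<omega>))) < ennreal \<epsilon>"
    proof (intro exI[of _ \<delta>] conjI \<open>0 < \<delta>\<close> ballI impI \<delta>)
      fix f' g' assume "f' \<in> LE" "g' \<in> Lw"
        and less: "max (Ls_norm M r LvC0_norm (f' - f)) (Ls_norm M q (sup_norm T unorm) (g' - g)) < ennreal \<delta>"
      then show "strongly_measurable M LvC0 LvC0_norm f'"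
        "strongly_measurable M (C0 T UNIV unorm) (sup_norm T unorm) g'"
        using Lw_C0 by (simp_all add: LE Ls_space_iff)
      show "Ls_norm M r LvC0_norm (f' - f) < ennreal \<delta>" "Ls_norm M q (sup_norm T unorm) (g' - g) < ennreal \<delta>"
        using less by auto
    qed
  qed
  ultimately show ?thesis
    by blast
qed

end
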